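(* Let $\mathsf H$ be a separable Hilbert space and let $\phi:\mathcal P_2(\mathsf H)\to\mathbb R\cup\{+\infty\}$ be a geodesically convex function which is lower semicontinuous with respect to the distance $W_2$. Then $\phi$ is sequentially lower semicontinuous with respect to the (weak) topology of $\mathcal P_2^w(\mathsf H)$: for every sequence $(\mu_n)_{n\in\mathbb N}$ in $\mathcal P_2(\mathsf H)$ and every $\mu\in\mathcal P_2(\mathsf H)$, $$\mu_n\to\mu\ \text{ narrowly in }\mathcal P(\mathsf H_w),\quad \sup_n\int_{\mathsf H}|x|^2\,\mathrm d\mu_n(x)<\infty\quad\Longrightarrow\quad \liminf_{n\to\infty}\phi(\mu_n)\ge\phi(\mu).$$
   Context: $(\mathsf H,|\cdot|)$ is a separable Hilbert space; $\mathsf H_w$ denotes $\mathsf H$ with its weak topology (it has the same Borel sets as $\mathsf H$). $\mathcal P_2(\mathsf H)$ is the set of Borel probability measures $\mu$ on $\mathsf H$ with $\int|x|^2\,\mathrm d\mu<\infty$. For $\mu_0,\mu_1\in\mathcal P_2(\mathsf H)$, $\Gamma(\mu_0,\mu_1)$ is the set of Borel probability measures on $\mathsf H\times\mathsf H$ with marginals $\mu_0,\mu_1$; $W_2^2(\mu_0,\mu_1)=\min\{\int|x_1-x_2|^2\,\mathrm d\boldsymbol\mu:\boldsymbol\mu\in\Gamma(\mu_0,\mu_1)\}$; $\Gamma_o(\mu_0,\mu_1)$ is the set of minimizers (optimal plans). Narrow convergence in $\mathcal P(\mathsf H_w)$: $\int f\,\mathrm d\mu_n\to\int f\,\mathrm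 d\mu$ for every bounded weakly continuous $f:\mathsf H\to\mathbb R$. $\mathcal P_2^w(\mathsf H)$ is the set $\mathcal P_2(\mathsf H)$ endowed with the coarsest topology making all maps $\mu\mapsto\int\zeta\,\mathrm d\mu$ continuous, where $\zeta:\mathsf H\to\mathbb R$ ranges over the sequentially weakly continuous functions with $\lim_{|x|\to\infty}\zeta(x)/(1+|x|^2)=0$. A sequence converges in $\mathcal P_2^w(\mathsf H)$ if and only if it converges narrowly in $\mathcal P(\mathsf H_w)$ and has bounded second moments. Geodesic convexity: $\phi:\mathcal P_2(\mathsf H)\to\mathbb R\cup\{+\infty\}$, with nonempty proper domain $D(\phi)=\{\mu:\phi(\mu)<\infty\}$, is geodesically convex if for every $\mu_0,\mu_1\in D(\phi)$ there exists $\boldsymbol\mu\in\Gamma_o(\mu_0,\mu_1)$ such that $\phi((\pi^{1\to2}_s)_\sharp\boldsymbol\mu)\le(1-s)\phi(\mu_0)+s\phi(\mu_1)$ for every $s\in[0,1]$, where $\pi^{1\to2}_s(x_1,x_2)=(1-s)x_1+sx_2$ and $\sharp$ denotes push-forward. *)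

theory Defs
  imports "HOL-Probability.Probability"
begin

text \<open>
  A separable Hilbert space is a type of sort \<open>{real_inner, polish_space}\<close>: a complete real inner
  product space whose topology is second countable (for metric spaces: separable). Measures are
  always taken on the Borel sets of the norm topology.
\<close>

section \<open>The weak topology and narrow convergence\<close>

definition weak_topology :: "'h::real_normed_vector topology" where
  "weak_topology =
     topology_generated_by {f -` U | (f :: 'h \<Rightarrow> real) U. bounded_linear f \<and> open U}"

lemma topspace_weak_topology [simp]: "topspace (weak_topology :: 'h::real_normed_vector topology) = UNIV"
proof -
  have "(\<lambda>x::'h. 0::real) -` UNIV
          \<in> {f -` U | (f :: 'h \<Rightarrow> real) U. bounded_linear f \<and> open U}"
    using bounded_linear_zero[where 'a='h and 'b=real] open_UNIV[where 'a=real] by blast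
  then show ?thesis
    unfolding weak_topology_def topology_generated_by_topspace by blast
qed

definition narrow_conv_weak ::
    "(nat \<Rightarrow> 'h::real_normed_vector measure) \<Rightarrow> 'h measure \<Rightarrow> bool" where
  "narrow_conv_weak M N \<longleftrightarrow>
     (\<forall>f :: 'h \<Rightarrow> real. continuous_map weak_topology euclideanreal f \<and> bounded (range f) \<longrightarrow>
        (\<lambda>n. \<integral>x. f x \<partial>M n) \<longlonglongrightarrow> (\<integral>x. f x \<partial>N))"

section \<open>Wasserstein space\<close>

definition P2 :: "'h::real_normed_vector measure set" where
  "P2 = {M. prob_space M \<and> sets M = sets borel \<and> integrable M (\<lambda>x. (norm x)\<^sup>2)}"

definition plans :: "'h::real_normed_vector measure \<Rightarrow> 'h measure \<Rightarrow> ('h \<times> 'h) measure set" where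
  "plans M0 M1 = {G. prob_space G \<and> sets G = sets borel \<and>
                     distr G borel fst = M0 \<and> distr G borel snd = M1}"

definition transport_cost :: "('h::real_normed_vector \<times> 'h) measure \<Rightarrow> real" where
  "transport_cost G = (\<integral>z. (norm (fst z - snd z))\<^sup>2 \<partial>G)"

text \<open>
  The distance is written with an infimum, which is meaningful without first proving that optimal
  plans exist. On \<open>P2\<close> the set of plans is nonempty (product measure) and all costs are
  finite and nonnegative, so this is the usual value, attained precisely at the optimal plans.
\<close>

definition W2 :: "'h::real_normed_vector measure \<Rightarrow> 'h measure \<Rightarrow> real" where
  "W2 M0 M1 = sqrt (INF G\<in>plans M0 M1. transport_cost G)"

definition optimal_plans ::
    "'h::real_normed_vector measure \<Rightarrow> 'h measure \<Rightarrow> ('h \<times> 'h) measure set" where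
  "optimal_plans M0 M1 =
     {G \<in> plans M0 M1. \<forall>G' \<in> plans M0 M1. transport_cost G \<le> transport_cost G'}"

section \<open>The weak topology on the Wasserstein space\<close>

definition seq_weakly_continuous :: "('h::real_normed_vector \<Rightarrow> real) \<Rightarrow> bool" where
  "seq_weakly_continuous f \<longleftrightarrow>
     (\<forall>x l. limitin weak_topology x l sequentially \<longrightarrow> (\<lambda>n. f (x n)) \<longlonglongrightarrow> f l)"

definition P2w_test_functions :: "('h::real_normed_vector \<Rightarrow> real) set" where
  "P2w_test_functions =
     {f. seq_weakly_continuous f \<and> ((\<lambda>x. f x / (1 + (norm x)\<^sup>2)) \<longlongrightarrow> 0) at_infinity}"

definition P2w_topology :: "'h::real_normed_vector measure topology" where
  "P2w_topology = topology_generated_by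
     {{M \<in> P2. (\<integral>x. f x \<partial>M) \<in> U} | f U. f \<in> P2w_test_functions \<and> open U}"

lemma topspace_P2w_topology [simp]:
  "topspace (P2w_topology :: 'h::real_normed_vector measure topology) = P2"
proof -
  let ?S = "{{M \<in> P2 :: 'h measure set. (\<integral>x. f x \<partial>M) \<in> U} | f U.
               f \<in> P2w_test_functions \<and> open U}"
  have zero: "(\<lambda>x::'h. 0::real) \<in> P2w_test_functions"
    by (simp add: P2w_test_functions_def seq_weakly_continuous_def)
  have "P2 \<in> ?S"
    unfolding mem_Collect_eq
    by (intro exI[of _ "\<lambda>x::'h. 0::real"] exI[of _ "UNIV :: real set"]) (simp add: zero)
  moreover have "A \<subseteq> P2" if "A \<in> ?S" for A
    using that by auto
  ultimately show ?thesis
    unfolding P2w_topology_def topology_generated_by_topspace by (intro equalityI Union_least Union_upper)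
qed

section \<open>Functionals\<close>

text \<open>
  A functional with values in \<open>(-\<infinity>, \<infinity>]\<close> on \<open>P2\<close> is a function into the extended reals that avoids
  \<open>-\<infinity>\<close> on \<open>P2\<close>; its values on other measures are never used.
\<close>

definition proper_domain :: "('h::real_normed_vector measure \<Rightarrow> ereal) \<Rightarrow> 'h measure set" where
  "proper_domain \<phi> = {M \<in> P2. \<phi> M < \<infinity>}"

definition geodesically_convex :: "('h::real_normed_vector measure \<Rightarrow> ereal) \<Rightarrow> bool" where
  "geodesically_convex \<phi> \<longleftrightarrow>
     (\<forall>M0 \<in> proper_domain \<phi>. \<forall>M1 \<in> proper_domain \<phi>. \<exists>G \<in> optimal_plans M0 M1.
        \<forall>s \<in> {0..1}. \<phi> (distr G borel (\<lambda>z. (1 - s) *\<^sub>R fst z + s *\<^sub>R snd z))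
                        \<le> ereal (1 - s) * \<phi> M0 + ereal s * \<phi> M1)"

definition W2_lsc :: "('h::real_normed_vector measure \<Rightarrow> ereal) \<Rightarrow> bool" where
  "W2_lsc \<phi> \<longleftrightarrow>
     (\<forall>M \<in> P2. \<forall>c < \<phi> M. \<exists>\<delta>>0. \<forall>N \<in> P2. W2 M N < \<delta> \<longrightarrow> c < \<phi> N)"

definition seq_lsc_in :: "'a topology \<Rightarrow> ('a \<Rightarrow> ereal) \<Rightarrow> bool" where
  "seq_lsc_in X \<phi> \<longleftrightarrow>
     (\<forall>\<sigma> l. range \<sigma> \<subseteq> topspace X \<and> limitin X \<sigma> l sequentially \<longrightarrow>
        \<phi> l \<le> liminf (\<lambda>n. \<phi> (\<sigma> n)))"

end

theory Submission
  imports Defs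
begin

text \<open>
  Let \<open>K\<close> be a sublevel set of \<open>\<phi>\<close> containing (a subsequence of) \<open>\<mu>\<^sub>n\<close>, and let \<open>d\<close> be the infimum
  of \<open>W\<^sub>2\<^sup>2(\<mu>, \<cdot>)\<close> on \<open>K\<close>. For \<open>\<nu> \<in> K\<close> take the geodesic \<open>\<nu>\<^sub>t\<close> in \<open>K\<close> from \<open>\<nu>\<close> to \<open>\<mu>\<^sub>n\<close>, induced by
  an optimal plan. Since \<open>\<mu>\<^sub>n\<close> is weakly close to \<open>\<mu>\<close>, that plan \<open>(X, Z)\<close> can be glued to a variable
  \<open>Y\<close> of law \<open>\<mu>\<close> such that \<open>\<langle>X, Y - Z\<rangle>\<close> and \<open>\<langle>Y, Y - Z\<rangle>\<close> have almost vanishing expectation; the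
  same gluing, applied to a near-optimal plan between \<open>\<nu>\<close> and \<open>\<mu>\<close>, together with the optimality of
  \<open>(X, Z)\<close> shows that \<open>(X, Y)\<close> is almost optimal. Expanding
  \<open>|(1 - t)(Y - X) + t(Y - Z)|\<^sup>2\<close> then gives \<open>W\<^sub>2\<^sup>2(\<mu>, \<nu>\<^sub>t) \<le> (1 - t)\<^sup>2 W\<^sub>2\<^sup>2(\<mu>, \<nu>) + C t\<^sup>2 + o(1)\<close>, so
  \<open>d \<le> (1 - t)\<^sup>2 d + C t\<^sup>2\<close> for all small \<open>t\<close>, which forces \<open>d = 0\<close> and contradicts strong lower
  semicontinuity if \<open>\<phi>(\<mu>)\<close> exceeds the level.
\<close>

section \<open>The weak topology and weakly continuous partitions of unity\<close>

lemma continuous_map_weak_inner: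
  "continuous_map weak_topology euclideanreal (\<lambda>x. inner e x)"
proof -
  have "openin weak_topology {x. inner e x \<in> U}" if "open U" for U
  proof -
    have "(\<lambda>x. inner e x) -` U \<in> {f -` U | (f :: 'a \<Rightarrow> real) U. bounded_linear f \<and> open U}"
      using that bounded_linear_inner_right by blast
    then show ?thesis
      unfolding weak_topology_def by (auto intro!: topology_generated_by_Basis simp: vimage_def)
  qed
  then show ?thesis by (simp add: continuous_map_def)
qed

text \<open>Simple functions approximate the identity pointwise, and dominated convergence turns
  this into approximation in the L2 sense. The finite range is what matters later: only finitely
  many vectors have to be tested.\<close>

lemma L2_simple_approx:
  fixes M :: "'h::{real_inner,second_countable_topology} measure"
  assumes M: "M \<in> P2" and \<eta>: "\<eta> > 0"
  obtains s where "s \<in> borel_measurable borel" "finite (range s)"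
    "integrable M (\<lambda>x. (norm (x - s x))\<^sup>2)" "(\<integral>x. (norm (x - s x))\<^sup>2 \<partial>M) < \<eta>"
proof -
  have sM [measurable_cong]: "sets M = sets borel" and iM: "integrable M (\<lambda>x. (norm x)\<^sup>2)"
    using M by (auto simp: P2_def)
  obtain F where F: "\<And>i. simple_function borel (F i)" "\<And>x. (\<lambda>i. F i x) \<longlonglongrightarrow> (x::'h)"
      "\<And>i x. dist (F i x) 0 \<le> 2 * dist x 0"
    using borel_measurable_implies_sequence_metric[of "\<lambda>x::'h. x" borel 0] by auto
  have Fm [measurable]: "F i \<in> borel_measurable borel" for i
    by (rule borel_measurable_simple_function[OF F(1)])
  \<comment> \<open>The constant 9 is (1 + 2)^2, where 2 is the factor in
    \<open>F(3)\<close>.\<close>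
  have bd: "(norm (x - F i x))\<^sup>2 \<le> 9 * (norm x)\<^sup>2" for i x
  proof -
    have "norm (x - F i x) \<le> 3 * norm x"
      using norm_triangle_ineq4[of x "F i x"] F(3)[of i x] by simp
    then have "(norm (x - F i x))\<^sup>2 \<le> (3 * norm x)\<^sup>2" by (intro power_mono) auto
    then show ?thesis by (simp add: power_mult_distrib)
  qed
  have int: "integrable M (\<lambda>x. (norm (x - F i x))\<^sup>2)" for i
    by (rule Bochner_Integration.integrable_bound[OF integrable_mult_right[OF iM, of 9]]) (use bd in auto)
  have "(\<lambda>i. \<integral>x. (norm (x - F i x))\<^sup>2 \<partial>M) \<longlonglongrightarrow> (\<integral>x. 0 \<partial>M)"
  proof (rule integral_dominated_convergence[where w="\<lambda>x. 9 * (norm x)\<^sup>2"])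
    have "(\<lambda>i. (norm (x - F i x))\<^sup>2) \<longlonglongrightarrow> (norm (x - x))\<^sup>2" for x
      by (intro tendsto_intros F(2))
    then show "AE x in M. (\<lambda>i. (norm (x - F i x))\<^sup>2) \<longlonglongrightarrow> 0" by simp
  qed (use bd iM in auto)
  then have "eventually (\<lambda>i. (\<integral>x. (norm (x - F i x))\<^sup>2 \<partial>M) < \<eta>) sequentially"
    using \<eta> by (simp add: order_tendsto_iff)
  then obtain i where "(\<integral>x. (norm (x - F i x))\<^sup>2 \<partial>M) < \<eta>"
    by (auto simp: eventually_sequentially)
  moreover have "finite (range (F i))"
    using F(1)[of i] by (simp add: simple_function_def)
  ultimately show ?thesis using that[of "F i"] int Fm by blast
qed

text \<open>Telescoping: the \<open>j\<close>-th term is the drop of the product when the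
  \<open>j\<close>-th factor enters. For \<open>\<psi>\<close> with values in [0, 1] the family thus
  sums to at most one, and the product is the defect.\<close>

lemma sum_stick_breaking:
  fixes \<psi> :: "nat \<Rightarrow> real"
  shows "(\<Sum>j<m. \<psi> j * (\<Prod>i<j. 1 - \<psi> i)) = 1 - (\<Prod>i<m. 1 - \<psi> i)"
  by (induction m) (auto simp: algebra_simps)

text \<open>Bumps in the seminorm given by \<open>E\<close>, centred at a countable dense set,
  become a sub-partition of unity by stick breaking. Separability makes the bumps cover the space,
  so finitely many of them carry all but \<open>\<epsilon>\<close> of the mass.\<close>

lemma weak_partition:
  fixes M :: "'h::{real_inner,second_countable_topology} measure"
  assumes M: "prob_space M" "sets M = sets borel" and E: "finite E" and \<epsilon>: "\<epsilon> > 0"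
  obtains m :: nat and \<phi> :: "nat \<Rightarrow> 'h \<Rightarrow> real" where
    "\<And>j. continuous_map weak_topology euclideanreal (\<phi> j)"
    "\<And>j. \<phi> j \<in> borel_measurable borel"
    "\<And>j x. 0 \<le> \<phi> j x" "\<And>x. (\<Sum>j<m. \<phi> j x) \<le> 1"
    "(\<Sum>j<m. \<integral>x. \<phi> j x \<partial>M) > 1 - \<epsilon>"
    "\<And>j y z. \<phi> j y \<noteq> 0 \<Longrightarrow> \<phi> j z \<noteq> 0 \<Longrightarrow> (\<Sum>e\<in>E. \<bar>inner e (y - z)\<bar>) \<le> \<epsilon>"
proof -
  interpret prob_space M by fact
  note [measurable_cong] = M(2)
  define p :: "'h \<Rightarrow> real" where "p v = (\<Sum>e\<in>E. \<bar>inner e v\<bar>)" for v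
  define R where "R = (\<Sum>e\<in>E. norm e)"
  have R0: "R \<ge> 0" by (simp add: R_def sum_nonneg)
  have pR: "p v \<le> R * norm v" for v
    unfolding p_def R_def sum_distrib_right by (intro sum_mono Cauchy_Schwarz_ineq2)
  have ptri: "p (y - z) \<le> p (y - c) + p (z - c)" for y z c
  proof -
    have "\<bar>inner e (y - z)\<bar> \<le> \<bar>inner e (y - c)\<bar> + \<bar>inner e (z - c)\<bar>" for e
      by (simp add: inner_diff_right)
    then show ?thesis unfolding p_def sum.distrib[symmetric] by (rule sum_mono)
  qed
  obtain D :: "'h set" where D: "countable D" "\<And>X. open X \<Longrightarrow> X \<noteq> {} \<Longrightarrow> \<exists>d\<in>D. d \<in> X"
    using countable_dense_exists[where 'a='h] by auto
  have Dne: "D \<noteq> {}" using D(2)[of UNIV] by auto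
  define c where "c = from_nat_into D"
  \<comment> \<open>The bump is 1 where \<open>p (x - c j) \<le> \<epsilon> / 4\<close> and vanishes
    once this seminorm reaches \<open>\<epsilon> / 2\<close>, so two points of one support differ by
    at most \<open>\<epsilon>\<close>. It sees \<open>x\<close> through finitely many functionals
    only, hence is weakly continuous.\<close>
  define \<psi> where "\<psi> j x = max 0 (min 1 (2 - 4 / \<epsilon> * p (x - c j)))" for j x
  define \<phi> where "\<phi> j x = \<psi> j x * (\<Prod>i<j. 1 - \<psi> i x)" for j x
  have \<psi>01: "0 \<le> \<psi> j x" "\<psi> j x \<le> 1" for j x by (auto simp: \<psi>_def)
  have cp: "continuous_map weak_topology euclideanreal (\<lambda>x. p (x - c j))" for j
    unfolding p_def inner_diff_right
    by (intro continuous_map_sum continuous_map_real_abs continuous_map_diff continuous_map_weak_inner) (auto simp: E)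
  have c\<psi>: "continuous_map weak_topology euclideanreal (\<psi> j)" for j
    unfolding \<psi>_def
    by (intro continuous_map_real_max continuous_map_real_min continuous_map_diff continuous_map_real_mult cp) auto
  have c\<phi>: "continuous_map weak_topology euclideanreal (\<phi> j)" for j
    unfolding \<phi>_def
    by (intro continuous_map_real_mult continuous_map_prod continuous_map_diff c\<psi>) auto
  have [measurable]: "\<psi> j \<in> borel_measurable borel" for j
    unfolding \<psi>_def p_def by measurable
  have m\<phi> [measurable]: "\<phi> j \<in> borel_measurable borel" for j
    unfolding \<phi>_def by measurable
  have prod01: "0 \<le> (\<Prod>i<j. 1 - \<psi> i x)" "(\<Prod>i<j. 1 - \<psi> i x) \<le> 1" for j x
    by (auto intro!: prod_nonneg prod_le_1 simp: \<psi>01)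
  have \<phi>0: "0 \<le> \<phi> j x" and \<phi>1: "\<phi> j x \<le> 1" for j x
    unfolding \<phi>_def using \<psi>01[of j x] prod01[of x j] by (auto intro: mult_le_one)
  \<comment> \<open>Some centre is norm-close to \<open>x\<close>, and \<open>p\<close> is
    controlled by the norm; hence one bump equals 1 at \<open>x\<close> and the product vanishes
    from then on. Using \<open>R + 1\<close> keeps the divisor positive.\<close>
  have lim0: "(\<lambda>m. \<Prod>i<m. 1 - \<psi> i x) \<longlonglongrightarrow> 0" for x
  proof -
    have "0 < \<epsilon> / (4 * (R + 1))" using \<epsilon> R0 by (intro divide_pos_pos) auto
    then have "ball x (\<epsilon> / (4 * (R + 1))) \<noteq> {}" by (simp only: ball_eq_empty not_le)
    then obtain d where d: "d \<in> D" "dist x d < \<epsilon> / (4 * (R + 1))"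
      using D(2)[of "ball x (\<epsilon> / (4 * (R + 1)))"] by auto
    then obtain k where k: "d = c k"
      unfolding c_def using from_nat_into_surj[OF D(1)] by metis
    have "p (x - d) \<le> (R + 1) * norm (x - d)"
      using pR[of "x - d"] by (rule order_trans) (simp add: mult_right_mono)
    also have "\<dots> \<le> (R + 1) * (\<epsilon> / (4 * (R + 1)))"
      using d(2) R0 by (intro mult_left_mono) (auto simp: dist_norm)
    also have "\<dots> = \<epsilon> / 4" using R0 by (simp add: field_simps)
    finally have "\<psi> k x = 1" using \<epsilon> by (simp add: \<psi>_def k field_simps)
    then have "(\<Prod>i<m. 1 - \<psi> i x) = 0" if "m > k" for m
      using that by (intro prod_zero) auto
    then show ?thesis
      by (intro tendsto_eventually) (auto simp: eventually_at_top_dense)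
  qed
  \<comment> \<open>The uncovered mass tends to 0, which permits stopping at a finite
    \<open>m\<close>.\<close>
  have "(\<lambda>m. \<integral>x. (\<Prod>i<m. 1 - \<psi> i x) \<partial>M) \<longlonglongrightarrow> (\<integral>x. 0 \<partial>M)"
    by (rule integral_dominated_convergence[where w="\<lambda>_. 1"]) (use lim0 prod01 in auto)
  then have "eventually (\<lambda>m. (\<integral>x. (\<Prod>i<m. 1 - \<psi> i x) \<partial>M) < \<epsilon>) sequentially"
    using \<epsilon> by (simp add: order_tendsto_iff)
  then obtain m where m: "(\<integral>x. (\<Prod>i<m. 1 - \<psi> i x) \<partial>M) < \<epsilon>"
    by (auto simp: eventually_sequentially)
  have s\<phi>: "(\<Sum>j<m. \<phi> j x) = 1 - (\<Prod>i<m. 1 - \<psi> i x)" for x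
    unfolding \<phi>_def by (rule sum_stick_breaking)
  have i\<phi>: "integrable M (\<phi> j)" for j
    by (rule integrable_const_bound[where B=1]) (use \<phi>0 \<phi>1 in auto)
  have ipr: "integrable M (\<lambda>x. \<Prod>i<m. 1 - \<psi> i x)"
    by (rule integrable_const_bound[where B=1]) (use prod01 in auto)
  have "(\<Sum>j<m. \<integral>x. \<phi> j x \<partial>M) = (\<integral>x. (\<Sum>j<m. \<phi> j x) \<partial>M)"
    by (rule Bochner_Integration.integral_sum[symmetric]) (rule i\<phi>)
  also have "\<dots> = 1 - (\<integral>x. (\<Prod>i<m. 1 - \<psi> i x) \<partial>M)"
    unfolding s\<phi> using ipr by (simp add: prob_space)
  finally have mass: "(\<Sum>j<m. \<integral>x. \<phi> j x \<partial>M) > 1 - \<epsilon>" using m by simp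
  have supp: "p (x - c j) \<le> \<epsilon> / 2" if "\<phi> j x \<noteq> 0" for j x
  proof -
    have "\<psi> j x \<noteq> 0" using that by (auto simp: \<phi>_def)
    then have "2 - 4 / \<epsilon> * p (x - c j) > 0" by (auto simp: \<psi>_def max_def min_def split: if_splits)
    then show ?thesis using \<epsilon> by (simp add: field_simps)
  qed
  have diam: "(\<Sum>e\<in>E. \<bar>inner e (y - z)\<bar>) \<le> \<epsilon>" if "\<phi> j y \<noteq> 0" "\<phi> j z \<noteq> 0" for j y z
    using ptri[of y z "c j"] supp[OF that(1)] supp[OF that(2)] by (simp add: p_def)
  show ?thesis
    by (rule that[of \<phi> m]) (use c\<phi> m\<phi> \<phi>0 mass diam s\<phi> prod01 in auto)
qed

section \<open>Couplings with prescribed label overlap\<close>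

text \<open>Density of a coupling with respect to the product measure. A coupling in this form can
  be attached to any variable of law \<open>\<alpha>\<close> by reweighting, with no disintegration.
  The sections integrate to one everywhere, not just almost everywhere.\<close>

definition coupling_density :: "'a measure \<Rightarrow> 'b measure \<Rightarrow> ('a \<Rightarrow> 'b \<Rightarrow> ennreal) \<Rightarrow> bool" where
  "coupling_density \<alpha> \<beta> h \<longleftrightarrow>
     (\<lambda>(z, y). h z y) \<in> borel_measurable (\<alpha> \<Otimes>\<^sub>M \<beta>) \<and>
     (\<forall>z\<in>space \<alpha>. (\<integral>\<^sup>+y. h z y \<partial>\<beta>) = 1) \<and>
     (\<forall>y\<in>space \<beta>. (\<integral>\<^sup>+z. h z y \<partial>\<alpha>) = 1)"

text \<open>\<open>\<phi> j x\<close> acts as the probability that \<open>x\<close> receives label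
  \<open>j\<close>, the missing mass staying unlabelled; \<open>N\<close> carries the sigma-algebra.
  In the application, points sharing a label are weakly close.\<close>

locale label_coupling =
  fixes m :: nat and \<phi> :: "nat \<Rightarrow> 'h \<Rightarrow> real" and N :: "'h measure" and \<delta> :: real
  assumes \<phi>_measurable: "\<And>j. \<phi> j \<in> borel_measurable N"
    and \<phi>_nonneg: "\<And>j x. 0 \<le> \<phi> j x"
    and \<phi>_sum: "\<And>x. (\<Sum>j<m. \<phi> j x) \<le> 1"
    and \<delta>: "0 < \<delta>" "\<delta> < 1"
begin

definition label_mass :: "'h measure \<Rightarrow> nat \<Rightarrow> real" where
  "label_mass \<alpha> j = (\<integral>x. \<phi> j x \<partial>\<alpha>)"

definition overlap :: "'h measure \<Rightarrow> 'h measure \<Rightarrow> nat \<Rightarrow> real" where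
  "overlap \<alpha> \<beta> j = (1 - \<delta>) * min (label_mass \<alpha> j) (label_mass \<beta> j)"

text \<open>Density with respect to \<open>\<alpha>\<close> of what remains after mass
  \<open>overlap \<alpha> \<beta> j\<close> is taken from each label \<open>j\<close>. For a label
  of mass zero the quotient is zero and nothing is removed.\<close>

definition rest :: "'h measure \<Rightarrow> 'h measure \<Rightarrow> 'h \<Rightarrow> real" where
  "rest \<alpha> \<beta> z = 1 - (\<Sum>j<m. overlap \<alpha> \<beta> j / label_mass \<alpha> j * \<phi> j z)"

definition rest_mass :: "'h measure \<Rightarrow> 'h measure \<Rightarrow> real" where
  "rest_mass \<alpha> \<beta> = 1 - (\<Sum>j<m. overlap \<alpha> \<beta> j)"

text \<open>Points with a common label are coupled with the largest possible weight (up to the factor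
  \<open>1 - \<delta>\<close>, which keeps the remaining mass positive), and the remaining masses independently.\<close>

definition label_density :: "'h measure \<Rightarrow> 'h measure \<Rightarrow> 'h \<Rightarrow> 'h \<Rightarrow> real" where
  "label_density \<alpha> \<beta> z y =
     (\<Sum>j<m. overlap \<alpha> \<beta> j / (label_mass \<alpha> j * label_mass \<beta> j) * \<phi> j z * \<phi> j y) +
     rest \<alpha> \<beta> z * rest \<beta> \<alpha> y / rest_mass \<alpha> \<beta>"

lemma overlap_commute: "overlap \<alpha> \<beta> j = overlap \<beta> \<alpha> j"
  by (simp add: overlap_def min.commute)

lemma rest_mass_commute: "rest_mass \<alpha> \<beta> = rest_mass \<beta> \<alpha>"
  by (simp add: rest_mass_def overlap_commute[of \<alpha> \<beta>])

lemma label_density_commute: "label_density \<alpha> \<beta> z y = label_density \<beta> \<alpha> y z"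
  unfolding label_density_def rest_mass_commute[of \<alpha> \<beta>] overlap_commute[of \<alpha> \<beta>]
  by (simp add: mult_ac)

lemma label_mass_nonneg: "0 \<le> label_mass \<alpha> j"
  unfolding label_mass_def by (rule Bochner_Integration.integral_nonneg) (rule \<phi>_nonneg)

lemma overlap_nonneg: "0 \<le> overlap \<alpha> \<beta> j"
  unfolding overlap_def using \<delta> label_mass_nonneg by simp

lemma overlap_ratio: "overlap \<alpha> \<beta> j / label_mass \<alpha> j \<le> 1"
proof -
  have "overlap \<alpha> \<beta> j \<le> 1 * label_mass \<alpha> j"
    unfolding overlap_def using \<delta> label_mass_nonneg by (intro mult_mono) auto
  then show ?thesis
    using label_mass_nonneg[of \<alpha> j] by (cases "label_mass \<alpha> j = 0") (auto simp: divide_le_eq)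
qed

lemma rest_nonneg: "0 \<le> rest \<alpha> \<beta> z"
proof -
  have "(\<Sum>j<m. overlap \<alpha> \<beta> j / label_mass \<alpha> j * \<phi> j z) \<le> (\<Sum>j<m. \<phi> j z)"
    by (intro sum_mono mult_left_le_one_le overlap_ratio \<phi>_nonneg divide_nonneg_nonneg
        overlap_nonneg label_mass_nonneg)
  then show ?thesis unfolding rest_def using \<phi>_sum[of z] by linarith
qed

lemma \<phi>_le_1: "j < m \<Longrightarrow> \<phi> j x \<le> 1"
  using member_le_sum[of j "{..<m}" "\<lambda>j. \<phi> j x"] \<phi>_nonneg \<phi>_sum[of x] by auto

lemma integrable_\<phi>:
  assumes "prob_space \<alpha>" "sets \<alpha> = sets N" "j < m"
  shows "integrable \<alpha> (\<phi> j)"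
proof -
  interpret prob_space \<alpha> by fact
  note [measurable_cong] = assms(2) and [measurable] = \<phi>_measurable
  show ?thesis
    by (rule integrable_const_bound[where B=1]) (use \<phi>_nonneg \<phi>_le_1[OF assms(3)] in auto)
qed

text \<open>The label masses sum to at most one, so the factor \<open>1 - \<delta>\<close> leaves at
  least \<open>\<delta>\<close>. This justifies the division in
  \<open>label_density\<close>.\<close>

lemma rest_mass_pos:
  assumes "prob_space \<alpha>" "sets \<alpha> = sets N"
  shows "0 < rest_mass \<alpha> \<beta>"
proof -
  interpret prob_space \<alpha> by fact
  have "(\<Sum>j<m. overlap \<alpha> \<beta> j) \<le> (\<Sum>j<m. (1 - \<delta>) * label_mass \<alpha> j)"
    unfolding overlap_def using \<delta> by (intro sum_mono mult_left_mono) auto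
  also have "\<dots> = (1 - \<delta>) * (\<integral>x. (\<Sum>j<m. \<phi> j x) \<partial>\<alpha>)"
    unfolding label_mass_def sum_distrib_left[symmetric]
    by (subst Bochner_Integration.integral_sum) (auto intro: integrable_\<phi>[OF assms])
  also have "(\<integral>x. (\<Sum>j<m. \<phi> j x) \<partial>\<alpha>) \<le> (\<integral>x. 1 \<partial>\<alpha>)"
    by (intro integral_mono Bochner_Integration.integrable_sum integrable_\<phi> assms) (auto simp: \<phi>_sum)
  then have "(1 - \<delta>) * (\<integral>x. (\<Sum>j<m. \<phi> j x) \<partial>\<alpha>) \<le> 1 - \<delta>"
    using \<delta> by (simp add: prob_space mult_left_le)
  finally show ?thesis unfolding rest_mass_def using \<delta> by linarith
qed

lemma integral_rest:
  assumes "prob_space \<alpha>" "sets \<alpha> = sets N"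
  shows "integrable \<alpha> (rest \<alpha> \<beta>)" "(\<integral>z. rest \<alpha> \<beta> z \<partial>\<alpha>) = rest_mass \<alpha> \<beta>"
proof -
  interpret prob_space \<alpha> by fact
  show "integrable \<alpha> (rest \<alpha> \<beta>)"
    unfolding rest_def
    by (intro Bochner_Integration.integrable_diff Bochner_Integration.integrable_sum
        integrable_mult_right integrable_\<phi> assms) auto
  have "(\<integral>z. rest \<alpha> \<beta> z \<partial>\<alpha>) = 1 - (\<Sum>j<m. overlap \<alpha> \<beta> j / label_mass \<alpha> j * (\<integral>z. \<phi> j z \<partial>\<alpha>))"
    unfolding rest_def
    by (subst Bochner_Integration.integral_diff)
      (auto simp: prob_space Bochner_Integration.integral_sum integrable_\<phi>[OF assms])
  \<comment> \<open>The label masses cancel; where the mass under \<open>\<alpha>\<close> is zero,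
    the overlap is zero too, being a multiple of a minimum of nonnegative masses.\<close>
  also have "\<dots> = rest_mass \<alpha> \<beta>"
    unfolding rest_mass_def label_mass_def[symmetric]
    using label_mass_nonneg[of \<beta>] by (intro arg_cong2[where f="(-)"] refl sum.cong) (auto simp: overlap_def min_def)
  finally show "(\<integral>z. rest \<alpha> \<beta> z \<partial>\<alpha>) = rest_mass \<alpha> \<beta>" .
qed

lemma label_density_nonneg:
  assumes "prob_space \<alpha>" "sets \<alpha> = sets N"
  shows "0 \<le> label_density \<alpha> \<beta> z y"
  unfolding label_density_def
  by (intro add_nonneg_nonneg sum_nonneg mult_nonneg_nonneg divide_nonneg_nonneg overlap_nonneg
      label_mass_nonneg \<phi>_nonneg rest_nonneg rest_mass_pos[OF assms, THEN less_imp_le])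

text \<open>The labelled part integrates to exactly what \<open>rest\<close> subtracts from one, and
  the independent part gives \<open>rest\<close> back.\<close>

lemma nn_integral_label_density:
  assumes \<alpha>: "prob_space \<alpha>" "sets \<alpha> = sets N" and \<beta>: "prob_space \<beta>" "sets \<beta> = sets N"
  shows "(\<integral>\<^sup>+y. ennreal (label_density \<alpha> \<beta> z y) \<partial>\<beta>) = 1"
proof -
  have R: "rest_mass \<beta> \<alpha> > 0" by (rule rest_mass_pos[OF \<beta>])
  have int: "integrable \<beta> (label_density \<alpha> \<beta> z)"
    unfolding label_density_def
    by (intro Bochner_Integration.integrable_add Bochner_Integration.integrable_sum
        integrable_mult_right integrable_\<phi> \<beta> integrable_divide integral_rest) auto
  have "(\<integral>y. label_density \<alpha> \<beta> z y \<partial>\<beta>) =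
      (\<Sum>j<m. overlap \<alpha> \<beta> j / (label_mass \<alpha> j * label_mass \<beta> j) * \<phi> j z * label_mass \<beta> j) +
      rest \<alpha> \<beta> z * rest_mass \<beta> \<alpha> / rest_mass \<alpha> \<beta>"
    unfolding label_density_def
    by (subst Bochner_Integration.integral_add)
      (auto simp: Bochner_Integration.integral_sum integral_rest[OF \<beta>] label_mass_def integrable_\<phi>[OF \<beta>]
        intro!: Bochner_Integration.integrable_sum)
  also have "\<dots> = (\<Sum>j<m. overlap \<alpha> \<beta> j / label_mass \<alpha> j * \<phi> j z) + rest \<alpha> \<beta> z"
    using R label_mass_nonneg
    by (intro arg_cong2[where f="(+)"] sum.cong)
       (auto simp: overlap_def min_def rest_mass_commute[of \<alpha> \<beta>] order_antisym_conv)
  also have "\<dots> = 1" by (simp add: rest_def)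
  finally show ?thesis
    using nn_integral_eq_integral[OF int] label_density_nonneg[OF \<alpha>] by simp
qed

lemma coupling_density_label_density:
  assumes \<alpha>: "prob_space \<alpha>" "sets \<alpha> = sets N" and \<beta>: "prob_space \<beta>" "sets \<beta> = sets N"
  shows "coupling_density \<alpha> \<beta> (\<lambda>z y. ennreal (label_density \<alpha> \<beta> z y))"
proof -
  note [measurable] = \<phi>_measurable and [measurable_cong] = \<alpha>(2) \<beta>(2)
  have "(\<lambda>(z, y). ennreal (label_density \<alpha> \<beta> z y)) \<in> borel_measurable (\<alpha> \<Otimes>\<^sub>M \<beta>)"
    unfolding label_density_def rest_def by measurable
  then show ?thesis
    unfolding coupling_density_def
    using nn_integral_label_density[OF \<alpha> \<beta>] nn_integral_label_density[OF \<beta> \<alpha>]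
    by (simp add: label_density_commute[of \<alpha> \<beta>])
qed

text \<open>On \<open>S\<close> no label is shared, so the labelled sum vanishes and only the
  independent remainder contributes; its total mass is
  \<open>rest_mass \<alpha> \<beta>\<close>.\<close>

lemma label_density_mismatch:
  assumes \<alpha>: "prob_space \<alpha>" "sets \<alpha> = sets N" and \<beta>: "prob_space \<beta>" "sets \<beta> = sets N"
    and S: "\<And>z y j. (z, y) \<in> S \<Longrightarrow> \<phi> j z = 0 \<or> \<phi> j y = 0"
  shows "(\<integral>\<^sup>+z. \<integral>\<^sup>+y. ennreal (label_density \<alpha> \<beta> z y) * indicator S (z, y) \<partial>\<beta> \<partial>\<alpha>)
      \<le> ennreal (rest_mass \<alpha> \<beta>)"
proof -
  note [measurable] = \<phi>_measurable and [measurable_cong] = \<alpha>(2) \<beta>(2)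
  have R: "rest_mass \<alpha> \<beta> > 0" by (rule rest_mass_pos[OF \<alpha>])
  have le: "ennreal (label_density \<alpha> \<beta> z y) * indicator S (z, y)
      \<le> ennreal (rest \<alpha> \<beta> z / rest_mass \<alpha> \<beta> * rest \<beta> \<alpha> y)" for z y
  proof (cases "(z, y) \<in> S")
    case True
    have "(\<Sum>j<m. overlap \<alpha> \<beta> j / (label_mass \<alpha> j * label_mass \<beta> j) * \<phi> j z * \<phi> j y) = 0"
      by (rule sum.neutral) (use S[OF True] in auto)
    then show ?thesis using True by (simp add: label_density_def)
  qed simp
  have "(\<integral>\<^sup>+z. \<integral>\<^sup>+y. ennreal (label_density \<alpha> \<beta> z y) * indicator S (z, y) \<partial>\<beta> \<partial>\<alpha>)
      \<le> (\<integral>\<^sup>+z. \<integral>\<^sup>+y. ennreal (rest \<alpha> \<beta> z / rest_mass \<alpha> \<beta> * rest \<beta> \<alpha> y) \<partial>\<beta> \<partial>\<alpha>)"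
    by (intro nn_integral_mono le)
  also have "\<dots> = (\<integral>\<^sup>+z. ennreal (rest \<alpha> \<beta> z) \<partial>\<alpha>)"
  proof (rule nn_integral_cong)
    fix z
    have "(\<integral>\<^sup>+y. ennreal (rest \<alpha> \<beta> z / rest_mass \<alpha> \<beta> * rest \<beta> \<alpha> y) \<partial>\<beta>)
        = ennreal (\<integral>y. rest \<alpha> \<beta> z / rest_mass \<alpha> \<beta> * rest \<beta> \<alpha> y \<partial>\<beta>)"
      using R integral_rest[OF \<beta>] rest_nonneg by (intro nn_integral_eq_integral) auto
    also have "\<dots> = ennreal (rest \<alpha> \<beta> z)"
      using R by (simp add: integral_rest[OF \<beta>] rest_mass_commute[of \<beta> \<alpha>])
    finally show "(\<integral>\<^sup>+y. ennreal (rest \<alpha> \<beta> z / rest_mass \<alpha> \<beta> * rest \<beta> \<alpha> y) \<partial>\<beta>) = ennreal (rest \<alpha> \<beta> z)" .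
  qed
  also have "\<dots> = ennreal (rest_mass \<alpha> \<beta>)"
    using integral_rest[OF \<alpha>] rest_nonneg by (subst nn_integral_eq_integral) auto
  finally show ?thesis .
qed

end

text \<open>Gluing by reweighting: the weight sees \<open>a\<close> only through \<open>f a\<close>,
  whose law is \<open>\<alpha>\<close>. Since the sections of \<open>h\<close> integrate to one,
  both marginals of the product survive, while \<open>(f a, b)\<close> acquires the coupling with
  density \<open>h\<close>.\<close>

lemma coupling_density_glue:
  fixes f :: "'a \<Rightarrow> 'b"
  assumes M: "prob_space M" and f: "f \<in> measurable M \<alpha>" "distr M \<alpha> f = \<alpha>"
    and \<beta>: "prob_space \<beta>" and h: "coupling_density \<alpha> \<beta> h"
  defines "\<pi> \<equiv> density (M \<Otimes>\<^sub>M \<beta>) (\<lambda>(a, b). h (f a) b)"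
  shows "prob_space \<pi>" "distr \<pi> M fst = M" "distr \<pi> \<beta> snd = \<beta>"
    "S \<in> sets (\<alpha> \<Otimes>\<^sub>M \<beta>) \<Longrightarrow> emeasure \<pi> {w \<in> space \<pi>. (f (fst w), snd w) \<in> S} =
       (\<integral>\<^sup>+z. \<integral>\<^sup>+y. h z y * indicator S (z, y) \<partial>\<beta> \<partial>\<alpha>)"
proof -
  interpret M: prob_space M by fact
  interpret B: prob_space \<beta> by fact
  interpret P: pair_prob_space M \<beta> ..
  note [measurable] = f(1)
  have hm [measurable]: "case_prod h \<in> borel_measurable (\<alpha> \<Otimes>\<^sub>M \<beta>)"
    using h by (simp add: coupling_density_def split_beta' case_prod_beta')
  have [measurable_cong, simp]: "sets \<pi> = sets (M \<Otimes>\<^sub>M \<beta>)" by (simp add: \<pi>_def)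
  have [simp]: "space \<pi> = space M \<times> space \<beta>" by (simp add: \<pi>_def space_pair_measure)
  have m1 [measurable]: "(\<lambda>(a, b). h (f a) b) \<in> borel_measurable (M \<Otimes>\<^sub>M \<beta>)"
  proof -
    have "(\<lambda>w. case_prod h (f (fst w), snd w)) \<in> borel_measurable (M \<Otimes>\<^sub>M \<beta>)" by measurable
    then show ?thesis by (simp add: split_beta')
  qed
  have em: "emeasure \<pi> A = (\<integral>\<^sup>+a. \<integral>\<^sup>+b. h (f a) b * indicator A (a, b) \<partial>\<beta> \<partial>M)"
    if [measurable]: "A \<in> sets (M \<Otimes>\<^sub>M \<beta>)" for A
    unfolding \<pi>_def by (simp add: emeasure_density B.nn_integral_fst[symmetric])
  have em': "emeasure \<pi> A = (\<integral>\<^sup>+b. \<integral>\<^sup>+a. h (f a) b * indicator A (a, b) \<partial>M \<partial>\<beta>)"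
    if [measurable]: "A \<in> sets (M \<Otimes>\<^sub>M \<beta>)" for A
    unfolding \<pi>_def by (simp add: emeasure_density P.nn_integral_snd[symmetric])
  have h1: "(\<integral>\<^sup>+b. h (f a) b \<partial>\<beta>) = 1" if "a \<in> space M" for a
    using h measurable_space[OF f(1) that] by (simp add: coupling_density_def)
  \<comment> \<open>Change of variables along \<open>f\<close> turns the integral over
    \<open>M\<close> into one over \<open>\<alpha>\<close>.\<close>
  have h2: "(\<integral>\<^sup>+a. h (f a) b \<partial>M) = 1" if b: "b \<in> space \<beta>" for b
  proof -
    have "(\<integral>\<^sup>+z. h z b \<partial>distr M \<alpha> f) = (\<integral>\<^sup>+a. h (f a) b \<partial>M)"
    proof (rule nn_integral_distr[OF f(1)])
      have "(\<lambda>z. case_prod h (z, b)) \<in> borel_measurable \<alpha>" using b by measurable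
      then show "(\<lambda>z. h z b) \<in> borel_measurable (distr M \<alpha> f)" by simp
    qed
    then show ?thesis using h b f(2) by (simp add: coupling_density_def)
  qed
  show d1: "distr \<pi> M fst = M"
  proof (rule measure_eqI)
    fix A assume "A \<in> sets (distr \<pi> M fst)"
    then have A [measurable]: "A \<in> sets M" by simp
    have "emeasure (distr \<pi> M fst) A = emeasure \<pi> (A \<times> space \<beta>)"
      using sets.sets_into_space[OF A] by (subst emeasure_distr) (auto intro!: arg_cong[where f="emeasure \<pi>"])
    also have "\<dots> = (\<integral>\<^sup>+a. \<integral>\<^sup>+b. h (f a) b * indicator A a \<partial>\<beta> \<partial>M)"
      by (subst em) (auto intro!: nn_integral_cong simp: indicator_def)
    also have "\<dots> = (\<integral>\<^sup>+a. indicator A a \<partial>M)"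
    proof (rule nn_integral_cong)
      fix a assume a: "a \<in> space M"
      then have fa: "f a \<in> space \<alpha>" using measurable_space[OF f(1)] by simp
      have "(\<lambda>y. case_prod h (f a, y)) \<in> borel_measurable \<beta>" using fa by measurable
      then have "(\<lambda>b. h (f a) b) \<in> borel_measurable \<beta>" by simp
      then show "(\<integral>\<^sup>+b. h (f a) b * indicator A a \<partial>\<beta>) = indicator A a"
        by (simp add: nn_integral_multc h1[OF a])
    qed
    finally show "emeasure (distr \<pi> M fst) A = emeasure M A" by simp
  qed simp
  show d2: "distr \<pi> \<beta> snd = \<beta>"
  proof (rule measure_eqI)
    fix A assume "A \<in> sets (distr \<pi> \<beta> snd)"
    then have A [measurable]: "A \<in> sets \<beta>" by simp
    have "emeasure (distr \<pi> \<beta> snd) A = emeasure \<pi> (space M \<times> A)"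
      using sets.sets_into_space[OF A] by (subst emeasure_distr) (auto intro!: arg_cong[where f="emeasure \<pi>"])
    also have "\<dots> = (\<integral>\<^sup>+b. \<integral>\<^sup>+a. h (f a) b * indicator A b \<partial>M \<partial>\<beta>)"
      by (subst em') (auto intro!: nn_integral_cong simp: indicator_def)
    also have "\<dots> = (\<integral>\<^sup>+b. indicator A b \<partial>\<beta>)"
    proof (rule nn_integral_cong)
      fix b assume b: "b \<in> space \<beta>"
      have "(\<lambda>a. case_prod h (f a, b)) \<in> borel_measurable M" using b by measurable
      then have "(\<lambda>a. h (f a) b) \<in> borel_measurable M" by simp
      then show "(\<integral>\<^sup>+a. h (f a) b * indicator A b \<partial>M) = indicator A b"
        by (simp add: nn_integral_multc h2[OF b])
    qed
    finally show "emeasure (distr \<pi> \<beta> snd) A = emeasure \<beta> A" by simp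
  qed simp
  show "prob_space \<pi>"
  proof
    have "emeasure \<pi> (space M \<times> space \<beta>) = emeasure (distr \<pi> M fst) (space M)"
      by (subst emeasure_distr) (auto intro!: arg_cong[where f="emeasure \<pi>"])
    then show "emeasure \<pi> (space \<pi>) = 1" by (simp add: d1 M.emeasure_space_1)
  qed
  show "emeasure \<pi> {w \<in> space \<pi>. (f (fst w), snd w) \<in> S} =
       (\<integral>\<^sup>+z. \<integral>\<^sup>+y. h z y * indicator S (z, y) \<partial>\<beta> \<partial>\<alpha>)"
    if S [measurable]: "S \<in> sets (\<alpha> \<Otimes>\<^sub>M \<beta>)"
  proof -
    have "{w \<in> space (M \<Otimes>\<^sub>M \<beta>). (f (fst w), snd w) \<in> S} \<in> sets (M \<Otimes>\<^sub>M \<beta>)" by measurable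
    then have "{w \<in> space \<pi>. (f (fst w), snd w) \<in> S} \<in> sets (M \<Otimes>\<^sub>M \<beta>)" by (simp add: space_pair_measure)
    then have "emeasure \<pi> {w \<in> space \<pi>. (f (fst w), snd w) \<in> S} =
        (\<integral>\<^sup>+a. \<integral>\<^sup>+b. h (f a) b * indicator S (f a, b) \<partial>\<beta> \<partial>M)"
      by (subst em) (auto intro!: nn_integral_cong simp: indicator_def)
    moreover have "(\<integral>\<^sup>+z. \<integral>\<^sup>+y. h z y * indicator S (z, y) \<partial>\<beta> \<partial>distr M \<alpha> f) =
        (\<integral>\<^sup>+a. \<integral>\<^sup>+b. h (f a) b * indicator S (f a, b) \<partial>\<beta> \<partial>M)"
    proof (rule nn_integral_distr[OF f(1)])
      have "(\<lambda>w. case_prod h w * indicator S w) \<in> borel_measurable (\<alpha> \<Otimes>\<^sub>M \<beta>)" by measurable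
      from B.borel_measurable_nn_integral_fst[OF this]
      show "(\<lambda>z. \<integral>\<^sup>+y. h z y * indicator S (z, y) \<partial>\<beta>) \<in> borel_measurable (distr M \<alpha> f)" by simp
    qed
    ultimately show ?thesis by (simp add: f(2))
  qed
qed

section \<open>Weakly small displacements\<close>

text \<open>Narrow convergence makes the finitely many label masses converge, so the overlap is
  eventually almost full and the remainder has mass at most \<open>\<epsilon>\<close>. Points in
  \<open>S\<close> are too far apart to share a label. Both orders are recorded because gluing is
  later done along either marginal.\<close>

lemma weak_coupling:
  fixes \<mu> :: "nat \<Rightarrow> 'h::{real_inner,second_countable_topology} measure"
  assumes \<mu>: "\<And>n. prob_space (\<mu> n)" "\<And>n. sets (\<mu> n) = sets borel"
    and \<mu>0: "prob_space \<mu>0" "sets \<mu>0 = sets borel"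
    and conv: "narrow_conv_weak \<mu> \<mu>0" and E: "finite E" and \<epsilon>: "\<epsilon> > 0"
  defines "S \<equiv> {(z, y). \<epsilon> < (\<Sum>e\<in>E. \<bar>inner e (y - z)\<bar>)}"
  shows "\<forall>\<^sub>F n in sequentially. \<exists>h. coupling_density (\<mu> n) \<mu>0 h \<and>
      coupling_density \<mu>0 (\<mu> n) (\<lambda>y z. h z y) \<and>
      (\<integral>\<^sup>+z. \<integral>\<^sup>+y. h z y * indicator S (z, y) \<partial>\<mu>0 \<partial>\<mu> n) \<le> ennreal \<epsilon> \<and>
      (\<integral>\<^sup>+y. \<integral>\<^sup>+z. h z y * indicator S (y, z) \<partial>\<mu> n \<partial>\<mu>0) \<le> ennreal \<epsilon>"
proof -
  have e4: "\<epsilon> / 4 > 0" using \<epsilon> by simp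
  obtain m :: nat and \<phi> :: "nat \<Rightarrow> 'h \<Rightarrow> real" where \<phi>: "\<And>j. continuous_map weak_topology euclideanreal (\<phi> j)"
    "\<And>j. \<phi> j \<in> borel_measurable borel" "\<And>j x. 0 \<le> \<phi> j x" "\<And>x. (\<Sum>j<m. \<phi> j x) \<le> 1"
    "(\<Sum>j<m. \<integral>x. \<phi> j x \<partial>\<mu>0) > 1 - \<epsilon> / 4"
    "\<And>j y z. \<phi> j y \<noteq> 0 \<Longrightarrow> \<phi> j z \<noteq> 0 \<Longrightarrow> (\<Sum>e\<in>E. \<bar>inner e (y - z)\<bar>) \<le> \<epsilon> / 4"
    by (rule weak_partition[OF \<mu>0 E e4]) blast
  \<comment> \<open>The bound 1/2 keeps \<open>\<delta>\<close> below one. The losses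
    \<open>\<delta>\<close> and \<open>\<epsilon> / 4\<close> (uncovered mass) then total at most
    \<open>\<epsilon> / 2\<close>.\<close>
  define \<delta> where "\<delta> = min (1 / 2) (\<epsilon> / 4)"
  have d: "0 < \<delta>" "\<delta> < 1" "\<delta> \<le> \<epsilon> / 4" using \<epsilon> by (auto simp: \<delta>_def)
  interpret label_coupling m \<phi> borel \<delta> by unfold_locales (use \<phi> d in auto)
  have lim: "(\<lambda>n. label_mass (\<mu> n) j) \<longlonglongrightarrow> label_mass \<mu>0 j" if "j < m" for j
  proof -
    have "bounded (range (\<phi> j))"
      unfolding bounded_iff using \<phi>(3) \<phi>_le_1[OF that] by (intro exI[of _ 1]) auto
    then show ?thesis
      using conv \<phi>(1)[of j] unfolding narrow_conv_weak_def label_mass_def by blast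
  qed
  \<comment> \<open>In the limit the minimum becomes the full label mass under
    \<open>\<mu>0\<close>, which exceeds \<open>1 - \<epsilon> / 4\<close>.\<close>
  have "(\<lambda>n. \<Sum>j<m. min (label_mass (\<mu> n) j) (label_mass \<mu>0 j)) \<longlonglongrightarrow>
        (\<Sum>j<m. min (label_mass \<mu>0 j) (label_mass \<mu>0 j))"
    by (intro tendsto_intros lim) auto
  then have "\<forall>\<^sub>F n in sequentially. 1 - \<epsilon> / 4 < (\<Sum>j<m. min (label_mass (\<mu> n) j) (label_mass \<mu>0 j))"
    by (rule order_tendstoD) (use \<phi>(5) in \<open>simp add: label_mass_def\<close>)
  then show ?thesis
  proof (eventually_elim)
    case (elim n)
    have "(1 - \<delta>) * (1 - \<epsilon> / 4) \<le> (1 - \<delta>) * (\<Sum>j<m. min (label_mass (\<mu> n) j) (label_mass \<mu>0 j))"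
      using elim d by (intro mult_left_mono) auto
    moreover have "(1 - \<delta>) * (1 - \<epsilon> / 4) = 1 - \<delta> - \<epsilon> / 4 + \<delta> * \<epsilon> / 4"
      by (simp add: field_simps)
    moreover have "\<delta> * \<epsilon> > 0" using d \<epsilon> by simp
    ultimately have "1 - \<epsilon> \<le> (1 - \<delta>) * (\<Sum>j<m. min (label_mass (\<mu> n) j) (label_mass \<mu>0 j))"
      using d \<epsilon> by linarith
    then have rm: "rest_mass (\<mu> n) \<mu>0 \<le> \<epsilon>"
      unfolding rest_mass_def overlap_def sum_distrib_left[symmetric] by linarith
    have S: "\<phi> j z = 0 \<or> \<phi> j y = 0" if "(z, y) \<in> S" for z y j
    proof (rule ccontr)
      assume "\<not> (\<phi> j z = 0 \<or> \<phi> j y = 0)"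
      then show False using \<phi>(6)[of j y z] that \<epsilon> by (simp add: S_def)
    qed
    have mis: "(\<integral>\<^sup>+z. \<integral>\<^sup>+y. ennreal (label_density (\<mu> n) \<mu>0 z y) * indicator S (z, y) \<partial>\<mu>0 \<partial>\<mu> n) \<le> ennreal \<epsilon>"
      by (rule order_trans[OF label_density_mismatch[OF \<mu> \<mu>0] ennreal_leI[OF rm]]) (rule S)
    have mis': "(\<integral>\<^sup>+y. \<integral>\<^sup>+z. ennreal (label_density (\<mu> n) \<mu>0 z y) * indicator S (y, z) \<partial>\<mu> n \<partial>\<mu>0) \<le> ennreal \<epsilon>"
      unfolding label_density_commute[of "\<mu> n" \<mu>0]
      by (rule order_trans[OF label_density_mismatch[OF \<mu>0 \<mu>] ennreal_leI[OF rm[unfolded rest_mass_commute[of "\<mu> n"]]]])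
        (rule S)
    show ?case
      using coupling_density_label_density[OF \<mu> \<mu>0, of n] coupling_density_label_density[OF \<mu>0 \<mu>, of n] mis mis'
      by (intro exI[of _ "\<lambda>z y. ennreal (label_density (\<mu> n) \<mu>0 z y)"])
         (simp add: label_density_commute[of "\<mu> n" \<mu>0])
  qed
qed

section \<open>Quadratic estimates for square-integrable maps\<close>

lemma norm_diff_sq_le: "(norm (x - y :: 'a::real_inner))\<^sup>2 \<le> 2 * (norm x)\<^sup>2 + 2 * (norm y)\<^sup>2"
proof -
  have "0 \<le> (norm (x + y))\<^sup>2" by simp
  then show ?thesis by (simp add: power2_norm_eq_inner inner_commute algebra_simps)
qed

text \<open>Young's inequality, from Cauchy-Schwarz and a completed square. The free
  \<open>a\<close> shifts weight between the two terms: small \<open>a\<close> absorbs a merely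
  bounded second factor if the first is very small.\<close>

lemma abs_inner_le_sq: "\<bar>inner x y\<bar> \<le> (norm x)\<^sup>2 / (4 * a) + a * (norm y)\<^sup>2" if "a > 0" for a :: real
proof -
  have "0 \<le> (norm x - 2 * a * norm y)\<^sup>2 / (4 * a)" using that by simp
  also have "\<dots> = (norm x)\<^sup>2 / (4 * a) + a * (norm y)\<^sup>2 - norm x * norm y"
    using that by (simp add: power2_eq_square field_simps)
  finally show ?thesis using Cauchy_Schwarz_ineq2[of x y] by linarith
qed

lemma integrable_norm_diff_sq:
  fixes X Y :: "'a \<Rightarrow> 'h::{real_inner,second_countable_topology}"
  assumes [measurable]: "X \<in> borel_measurable M" "Y \<in> borel_measurable M"
    and "integrable M (\<lambda>w. (norm (X w))\<^sup>2)" "integrable M (\<lambda>w. (norm (Y w))\<^sup>2)"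
  shows "integrable M (\<lambda>w. (norm (X w - Y w))\<^sup>2)"
  by (rule Bochner_Integration.integrable_bound[of M "\<lambda>w. 2 * (norm (X w))\<^sup>2 + 2 * (norm (Y w))\<^sup>2"])
     (use assms norm_diff_sq_le in auto)

lemma integrable_inner:
  fixes X Y :: "'a \<Rightarrow> 'h::{real_inner,second_countable_topology}"
  assumes [measurable]: "X \<in> borel_measurable M" "Y \<in> borel_measurable M"
    and "integrable M (\<lambda>w. (norm (X w))\<^sup>2)" "integrable M (\<lambda>w. (norm (Y w))\<^sup>2)"
  shows "integrable M (\<lambda>w. inner (X w) (Y w))"
proof (rule Bochner_Integration.integrable_bound[of M "\<lambda>w. (norm (X w))\<^sup>2 + (norm (Y w))\<^sup>2"])
  show "AE w in M. norm (inner (X w) (Y w)) \<le> norm ((norm (X w))\<^sup>2 + (norm (Y w))\<^sup>2)"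
  proof (rule AE_I2)
    fix w
    have "\<bar>inner (X w) (Y w)\<bar> \<le> (norm (X w))\<^sup>2 / 4 + (norm (Y w))\<^sup>2"
      using abs_inner_le_sq[of 1 "X w" "Y w"] by simp
    also have "\<dots> \<le> (norm (X w))\<^sup>2 + (norm (Y w))\<^sup>2" by simp
    finally show "norm (inner (X w) (Y w)) \<le> norm ((norm (X w))\<^sup>2 + (norm (Y w))\<^sup>2)" by simp
  qed
qed (use assms in auto)

text \<open>The finite set \<open>E\<close> contains the values of an \<open>L\<^sup>2\<close>-approximation \<open>s \<circ> X\<close> of \<open>X\<close>, which reduces
  the control of \<open>\<langle>X, V\<rangle>\<close> to finitely many functionals of \<open>V\<close>.\<close>

lemma (in prob_space) integral_inner_small:
  fixes X V :: "'a \<Rightarrow> 'h::{real_inner,second_countable_topology}"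
  assumes [measurable]: "X \<in> borel_measurable M" "V \<in> borel_measurable M" "s \<in> borel_measurable borel"
    and X: "integrable M (\<lambda>w. (norm (X w))\<^sup>2)" and V: "integrable M (\<lambda>w. (norm (V w))\<^sup>2)"
    and s: "integrable M (\<lambda>w. (norm (X w - s (X w)))\<^sup>2)" "(\<integral>w. (norm (X w - s (X w)))\<^sup>2 \<partial>M) \<le> A"
    and E: "finite E" "range s \<subseteq> E"
    and C: "(\<integral>w. (norm (V w))\<^sup>2 \<partial>M) \<le> C"
    and bad: "emeasure M {w\<in>space M. \<epsilon> < (\<Sum>e\<in>E. \<bar>inner e (V w)\<bar>)} \<le> ennreal \<epsilon>"
    and a: "a > 0" and \<epsilon>: "\<epsilon> > 0"
  shows "\<bar>\<integral>w. inner (X w) (V w) \<partial>M\<bar> \<le> A / (4 * a) + 2 * a * C + \<epsilon> + (\<Sum>e\<in>E. norm e)\<^sup>2 * \<epsilon> / (4 * a)"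
proof -
  define R where "R = (\<Sum>e\<in>E. norm e)"
  define B where "B = {w\<in>space M. \<epsilon> < (\<Sum>e\<in>E. \<bar>inner e (V w)\<bar>)}"
  have R0: "R \<ge> 0" by (simp add: R_def sum_nonneg)
  have Bm [measurable]: "B \<in> sets M" unfolding B_def by measurable
  have PB: "prob B \<le> \<epsilon>"
    using bad \<epsilon> by (simp add: B_def[symmetric] emeasure_eq_measure)
  \<comment> \<open>\<open>X\<close> is split into \<open>X - s X\<close>, treated by Young's
    inequality, and \<open>s X\<close>, which takes values in \<open>E\<close>.\<close>
  have pw: "\<bar>inner (X w) (V w)\<bar> \<le> (norm (X w - s (X w)))\<^sup>2 / (4 * a) + 2 * a * (norm (V w))\<^sup>2 + \<epsilon> +
      R\<^sup>2 / (4 * a) * indicator B w" if w: "w \<in> space M" for w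
  proof -
    have sE: "s (X w) \<in> E" using E by auto
    have 1: "\<bar>inner (s (X w)) (V w)\<bar> \<le> (\<Sum>e\<in>E. \<bar>inner e (V w)\<bar>)"
      by (rule member_le_sum[OF sE]) (auto simp: E)
    have "(\<Sum>e\<in>E. \<bar>inner e (V w)\<bar>) \<le> R * norm (V w)"
      unfolding R_def sum_distrib_right by (intro sum_mono Cauchy_Schwarz_ineq2)
    also have "\<dots> \<le> R\<^sup>2 / (4 * a) + a * (norm (V w))\<^sup>2"
      using abs_inner_le_sq[OF a, of R "norm (V w)"] R0 by simp
    finally have 2: "\<bar>inner (s (X w)) (V w)\<bar> \<le> R\<^sup>2 / (4 * a) + a * (norm (V w))\<^sup>2" using 1 by linarith
    \<comment> \<open>Off \<open>B\<close> the functionals in \<open>E\<close> are at most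
      \<open>\<epsilon>\<close>; on \<open>B\<close> the crude Young bound is used, whose constant
      is later multiplied by the small probability of \<open>B\<close>.\<close>
    have 3: "\<bar>inner (s (X w)) (V w)\<bar> \<le> \<epsilon> + R\<^sup>2 / (4 * a) * indicator B w + a * (norm (V w))\<^sup>2"
    proof (cases "w \<in> B")
      case True then show ?thesis using 2 \<epsilon> by simp
    next
      case False
      then have "(\<Sum>e\<in>E. \<bar>inner e (V w)\<bar>) \<le> \<epsilon>" using w by (simp add: B_def)
      moreover have "0 \<le> a * (norm (V w))\<^sup>2" using a by simp
      ultimately show ?thesis using 1 False by simp
    qed
    have "inner (X w) (V w) = inner (X w - s (X w)) (V w) + inner (s (X w)) (V w)"
      by (simp add: inner_diff_left)
    then show ?thesis
      using 3 abs_inner_le_sq[OF a, of "X w - s (X w)" "V w"] by linarith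
  qed
  have "\<bar>\<integral>w. inner (X w) (V w) \<partial>M\<bar> \<le> (\<integral>w. \<bar>inner (X w) (V w)\<bar> \<partial>M)"
    using integral_norm_bound[of M "\<lambda>w. inner (X w) (V w)"] by simp
  also have "\<dots> \<le> (\<integral>w. (norm (X w - s (X w)))\<^sup>2 / (4 * a) + 2 * a * (norm (V w))\<^sup>2 + \<epsilon> +
      R\<^sup>2 / (4 * a) * indicator B w \<partial>M)"
    by (intro integral_mono pw integrable_abs integrable_inner) (use X V s a in \<open>auto simp: emeasure_eq_measure\<close>)
  also have "\<dots> = (\<integral>w. (norm (X w - s (X w)))\<^sup>2 \<partial>M) / (4 * a) + 2 * a * (\<integral>w. (norm (V w))\<^sup>2 \<partial>M) + \<epsilon> +
      R\<^sup>2 / (4 * a) * prob B"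
    using X V s a by (simp add: emeasure_eq_measure prob_space)
  also have "\<dots> \<le> A / (4 * a) + 2 * a * C + \<epsilon> + R\<^sup>2 / (4 * a) * \<epsilon>"
    using s(2) C PB a by (intro add_mono mult_left_mono divide_right_mono order_refl) auto
  finally show ?thesis by (simp add: R_def)
qed

section \<open>Three-marginal plans\<close>

lemma borel_measurable_fst_snd:
  "fst \<in> borel_measurable (borel :: ('a::second_countable_topology \<times> 'b::second_countable_topology) measure)"
  "snd \<in> borel_measurable (borel :: ('a \<times> 'b) measure)"
  by (intro borel_measurable_continuous_onI continuous_intros)+

text \<open>Allows plans to be treated as pairs of random variables on a common space.\<close>

lemma plan_of_joint_law:
  fixes U V :: "'a \<Rightarrow> 'h::{real_inner,second_countable_topology}"
  assumes "prob_space M" and [measurable]: "U \<in> borel_measurable M" "V \<in> borel_measurable M"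
  shows "distr M borel (\<lambda>w. (U w, V w)) \<in> plans (distr M borel U) (distr M borel V)"
    "transport_cost (distr M borel (\<lambda>w. (U w, V w))) = (\<integral>w. (norm (U w - V w))\<^sup>2 \<partial>M)"
proof -
  interpret prob_space M by fact
  have m: "(\<lambda>w. (U w, V w)) \<in> borel_measurable M" by measurable
  show "distr M borel (\<lambda>w. (U w, V w)) \<in> plans (distr M borel U) (distr M borel V)"
    unfolding plans_def using m
    by (auto simp: distr_distr[OF borel_measurable_fst_snd(1)] distr_distr[OF borel_measurable_fst_snd(2)]
        comp_def intro!: prob_space_distr)
  show "transport_cost (distr M borel (\<lambda>w. (U w, V w))) = (\<integral>w. (norm (U w - V w))\<^sup>2 \<partial>M)"
    unfolding transport_cost_def by (subst integral_distr[OF m]) (auto intro!: borel_measurable_continuous_onI continuous_intros)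
qed

lemma P2_distr:
  fixes U :: "'a \<Rightarrow> 'h::{real_inner,second_countable_topology}"
  assumes "prob_space M" and [measurable]: "U \<in> borel_measurable M"
  shows "distr M borel U \<in> P2 \<longleftrightarrow> integrable M (\<lambda>w. (norm (U w))\<^sup>2)"
  using assms by (auto simp: P2_def integrable_distr_eq intro!: prob_space.prob_space_distr)

lemma integral_norm_sq_distr:
  fixes U :: "'a \<Rightarrow> 'h::{real_inner,second_countable_topology}"
  assumes [measurable]: "U \<in> borel_measurable M"
  shows "(\<integral>w. (norm (U w))\<^sup>2 \<partial>M) = (\<integral>x. (norm x)\<^sup>2 \<partial>distr M borel U)"
  by (simp add: integral_distr)

text \<open>Replacing \<open>Y\<close> by \<open>Z\<close> changes the cost by second moments, which
  depend on the laws only, and by an inner product with \<open>Z - Y\<close>. Applied to two gluings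
  with exchanged laws, the moments cancel.\<close>

lemma integral_norm_sq_shift:
  fixes X Y Z :: "'a \<Rightarrow> 'h::{real_inner,second_countable_topology}"
  assumes [measurable]: "X \<in> borel_measurable M" "Y \<in> borel_measurable M" "Z \<in> borel_measurable M"
    and X: "integrable M (\<lambda>w. (norm (X w))\<^sup>2)" and Y: "integrable M (\<lambda>w. (norm (Y w))\<^sup>2)"
    and Z: "integrable M (\<lambda>w. (norm (Z w))\<^sup>2)"
  shows "(\<integral>w. (norm (X w - Z w))\<^sup>2 \<partial>M) = (\<integral>w. (norm (X w - Y w))\<^sup>2 \<partial>M) +
    (\<integral>w. (norm (Z w))\<^sup>2 \<partial>M) - (\<integral>w. (norm (Y w))\<^sup>2 \<partial>M) - 2 * (\<integral>w. inner (X w) (Z w - Y w) \<partial>M)"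
proof -
  have "(norm (X w - Z w))\<^sup>2 = (norm (X w - Y w))\<^sup>2 + (norm (Z w))\<^sup>2 - (norm (Y w))\<^sup>2 -
      2 * inner (X w) (Z w - Y w)" for w
    by (simp add: power2_norm_eq_inner inner_commute algebra_simps)
  moreover have "integrable M (\<lambda>w. (norm (X w - Y w))\<^sup>2)" "integrable M (\<lambda>w. inner (X w) (Z w - Y w))"
    by (intro integrable_norm_diff_sq integrable_inner; measurable; use X Y Z in simp)+
  ultimately show ?thesis using Y Z by simp
qed

text \<open>The gluing is done along the second marginal of \<open>G\<close>. The result is a triple
  \<open>((X, Z), Y)\<close> in which \<open>(X, Z)\<close> has law \<open>G\<close> and
  \<open>Y\<close> has law \<open>\<beta>\<close>, weakly close to \<open>Z\<close> up to mass
  \<open>c\<close>. Second countability identifies the product and Borel sigma-algebras.\<close>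

lemma glue_plan:
  fixes \<nu> \<alpha> \<beta> :: "'h::{real_inner,second_countable_topology} measure"
  assumes G: "G \<in> plans \<nu> \<alpha>" and \<beta>: "prob_space \<beta>" "sets \<beta> = sets borel"
    and h: "coupling_density \<alpha> \<beta> h"
    and bad: "(\<integral>\<^sup>+z. \<integral>\<^sup>+y. h z y * indicator {(z, y). \<epsilon> < (\<Sum>e\<in>E. \<bar>inner e (y - z)\<bar>)} (z, y) \<partial>\<beta> \<partial>\<alpha>) \<le> c"
  obtains \<pi> :: "(('h \<times> 'h) \<times> 'h) measure" where "prob_space \<pi>" "sets \<pi> = sets borel"
    "distr \<pi> borel fst = G" "distr \<pi> borel snd = \<beta>"
    "emeasure \<pi> {w \<in> space \<pi>. \<epsilon> < (\<Sum>e\<in>E. \<bar>inner e (snd w - snd (fst w))\<bar>)} \<le> c"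
proof -
  have G': "prob_space G" "sets G = sets borel" "distr G borel snd = \<alpha>"
    using G by (auto simp: plans_def)
  have sa: "sets \<alpha> = sets borel" using G'(3) by auto
  have snd_m: "snd \<in> measurable G \<alpha>"
    unfolding measurable_cong_sets[OF G'(2) sa] borel_prod[symmetric] by measurable
  have "distr G \<alpha> snd = \<alpha>"
    using G'(3) by (subst distr_cong[of G G \<alpha> borel]) (auto simp: sa)
  note glue = coupling_density_glue[OF G'(1) snd_m this \<beta>(1) h]
  let ?\<pi> = "density (G \<Otimes>\<^sub>M \<beta>) (\<lambda>(a, b). h (snd a) b)"
  let ?S = "{(z, y). \<epsilon> < (\<Sum>e\<in>E. \<bar>inner e (y - z)\<bar>)}"
  have "{w \<in> space (borel \<Otimes>\<^sub>M borel). \<epsilon> < (\<Sum>e\<in>E. \<bar>inner e (snd w - fst w)\<bar>)} \<in> sets (borel \<Otimes>\<^sub>M borel :: ('h \<times> 'h) measure)"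
    by measurable
  also have "{w \<in> space (borel \<Otimes>\<^sub>M borel). \<epsilon> < (\<Sum>e\<in>E. \<bar>inner e (snd w - fst w)\<bar>)} = ?S"
    by (auto simp: space_pair_measure)
  finally have S: "?S \<in> sets (\<alpha> \<Otimes>\<^sub>M \<beta>)"
    by (simp add: sets_pair_measure_cong[OF sa \<beta>(2)])
  have sp: "sets ?\<pi> = sets borel"
    unfolding sets_density sets_pair_measure_cong[OF G'(2) \<beta>(2)] by (subst borel_prod) (rule refl)
  show ?thesis
  proof
    show "prob_space ?\<pi>" by (rule glue(1))
    show "sets ?\<pi> = sets borel" by (rule sp)
    show "distr ?\<pi> borel fst = G"
      using glue(2) by (subst distr_cong[of ?\<pi> ?\<pi> borel G]) (auto simp: G')
    show "distr ?\<pi> borel snd = \<beta>"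
      using glue(3) by (subst distr_cong[of ?\<pi> ?\<pi> borel \<beta>]) (auto simp: \<beta>)
    show "emeasure ?\<pi> {w \<in> space ?\<pi>. \<epsilon> < (\<Sum>e\<in>E. \<bar>inner e (snd w - snd (fst w))\<bar>)} \<le> c"
      using glue(4)[OF S] bad by simp
  qed
qed

lemma plans_P2_components:
  fixes \<pi> :: "(('h::{real_inner,second_countable_topology} \<times> 'h) \<times> 'h) measure"
  assumes \<pi>: "prob_space \<pi>" "sets \<pi> = sets borel" "distr \<pi> borel fst = G" "distr \<pi> borel snd = \<beta>"
    and G: "G \<in> plans \<nu> \<alpha>"
  shows "(\<lambda>w. fst (fst w)) \<in> borel_measurable \<pi>" "(\<lambda>w. snd (fst w)) \<in> borel_measurable \<pi>"
    "snd \<in> borel_measurable \<pi>" "fst \<in> borel_measurable \<pi>"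
    "distr \<pi> borel (\<lambda>w. fst (fst w)) = \<nu>" "distr \<pi> borel (\<lambda>w. snd (fst w)) = \<alpha>"
proof -
  note [measurable_cong] = \<pi>(2)
  have fm: "fst \<in> borel_measurable \<pi>" and "snd \<in> borel_measurable \<pi>"
    unfolding measurable_cong_sets[OF \<pi>(2) refl] by (rule borel_measurable_fst_snd)+
  then show "fst \<in> borel_measurable \<pi>" "snd \<in> borel_measurable \<pi>" by auto
  show "(\<lambda>w. fst (fst w)) \<in> borel_measurable \<pi>" "(\<lambda>w. snd (fst w)) \<in> borel_measurable \<pi>"
    using measurable_compose[OF fm borel_measurable_fst_snd(1)] measurable_compose[OF fm borel_measurable_fst_snd(2)] by auto
  show "distr \<pi> borel (\<lambda>w. fst (fst w)) = \<nu>" "distr \<pi> borel (\<lambda>w. snd (fst w)) = \<alpha>"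
    using G \<pi>(3) distr_distr[OF borel_measurable_fst_snd(1) fm] distr_distr[OF borel_measurable_fst_snd(2) fm] by (auto simp: plans_def comp_def)
qed

text \<open>The first factors of the inner products have law \<open>\<nu>\<close> or
  \<open>\<mu>0\<close>, which do not vary with \<open>n\<close>. One finite set \<open>E\<close>
  therefore serves all \<open>n\<close>, and one coupling of \<open>\<mu> n\<close> with
  \<open>\<mu>0\<close> serves all plans \<open>G\<close>.\<close>

lemma weak_coupling_plans:
  fixes \<mu> :: "nat \<Rightarrow> 'h::{real_inner,second_countable_topology} measure"
  assumes \<mu>: "\<And>n. \<mu> n \<in> P2" and \<mu>0: "\<mu>0 \<in> P2" and \<nu>: "\<nu> \<in> P2"
    and conv: "narrow_conv_weak \<mu> \<mu>0" and bd: "\<And>n. (\<integral>x. (norm x)\<^sup>2 \<partial>\<mu> n) \<le> C"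
    and \<eta>: "\<eta> > 0"
  shows "\<forall>\<^sub>F n in sequentially.
    (\<forall>G \<in> plans \<nu> (\<mu> n). \<exists>\<pi> :: (('h \<times> 'h) \<times> 'h) measure. prob_space \<pi> \<and> sets \<pi> = sets borel \<and>
       distr \<pi> borel fst = G \<and> distr \<pi> borel snd = \<mu>0 \<and>
       \<bar>\<integral>w. inner (fst (fst w)) (snd w - snd (fst w)) \<partial>\<pi>\<bar> \<le> \<eta> \<and>
       \<bar>\<integral>w. inner (snd w) (snd w - snd (fst w)) \<partial>\<pi>\<bar> \<le> \<eta>) \<and>
    (\<forall>G \<in> plans \<nu> \<mu>0. \<exists>\<pi> :: (('h \<times> 'h) \<times> 'h) measure. prob_space \<pi> \<and> sets \<pi> = sets borel \<and>
       distr \<pi> borel fst = G \<and> distr \<pi> borel snd = \<mu> n \<and>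
       \<bar>\<integral>w. inner (fst (fst w)) (snd w - snd (fst w)) \<partial>\<pi>\<bar> \<le> \<eta>)"
proof -
  \<comment> \<open>A bound, uniform in \<open>n\<close>, for the second moment of
    \<open>Y - Z\<close>.\<close>
  define C2 where "C2 = 2 * C + 2 * (\<integral>x. (norm x)\<^sup>2 \<partial>\<mu>0)"
  have "0 \<le> (\<integral>x. (norm x)\<^sup>2 \<partial>\<mu> 0)" "0 \<le> (\<integral>x. (norm x)\<^sup>2 \<partial>\<mu>0)" by auto
  then have C2: "C2 \<ge> 0" using bd[of 0] unfolding C2_def by linarith
  \<comment> \<open>The error in \<open>integral_inner_small\<close> has four terms, each to be at
    most \<open>\<eta> / 4\<close>. This \<open>a\<close> handles \<open>2 * a * C2\<close>;
    approximation within \<open>\<eta> * a\<close> handles the first term.\<close>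
  define a where "a = \<eta> / (8 * (C2 + 1))"
  have a: "a > 0" using \<eta> C2 by (simp add: a_def)
  have aC: "2 * a * C2 \<le> \<eta> / 4" using \<eta> C2 by (simp add: a_def field_simps)
  obtain s1 where s1: "s1 \<in> borel_measurable borel" "finite (range s1)"
    "integrable \<nu> (\<lambda>x. (norm (x - s1 x))\<^sup>2)" "(\<integral>x. (norm (x - s1 x))\<^sup>2 \<partial>\<nu>) < \<eta> * a"
    by (rule L2_simple_approx[OF \<nu> mult_pos_pos[OF \<eta> a]]) blast
  obtain s2 where s2: "s2 \<in> borel_measurable borel" "finite (range s2)"
    "integrable \<mu>0 (\<lambda>x. (norm (x - s2 x))\<^sup>2)" "(\<integral>x. (norm (x - s2 x))\<^sup>2 \<partial>\<mu>0) < \<eta> * a"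
    by (rule L2_simple_approx[OF \<mu>0 mult_pos_pos[OF \<eta> a]]) blast
  \<comment> \<open>\<open>s1\<close> serves the products with \<open>X\<close> (law
    \<open>\<nu>\<close>), \<open>s2\<close> the product with \<open>Y\<close> (law
    \<open>\<mu>0\<close>).\<close>
  define E where "E = range s1 \<union> range s2"
  have E: "finite E" "range s1 \<subseteq> E" "range s2 \<subseteq> E" using s1(2) s2(2) by (auto simp: E_def)
  define R where "R = (\<Sum>e\<in>E. norm e)"
  \<comment> \<open>The two arguments of the minimum make \<open>\<epsilon>\<close> and the bad-set
    term at most \<open>\<eta> / 4\<close> each.\<close>
  define \<epsilon> where "\<epsilon> = min (\<eta> / 4) (\<eta> * a / (R\<^sup>2 + 1))"
  have R1: "R\<^sup>2 + 1 > 0" by (simp add: add_nonneg_pos)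
  have \<epsilon>: "\<epsilon> > 0" using \<eta> a R1 by (simp add: \<epsilon>_def)
  have "R\<^sup>2 * \<epsilon> \<le> (R\<^sup>2 + 1) * (\<eta> * a / (R\<^sup>2 + 1))"
    using \<epsilon> by (intro mult_mono) (auto simp: \<epsilon>_def)
  also have "\<dots> = \<eta> * a" using R1 by simp
  finally have R\<epsilon>: "R\<^sup>2 * \<epsilon> / (4 * a) \<le> \<eta> / 4" using a by (simp add: field_simps)
  have tot: "\<eta> * a / (4 * a) + 2 * a * C2 + \<epsilon> + R\<^sup>2 * \<epsilon> / (4 * a) \<le> \<eta>"
  proof -
    have "\<epsilon> \<le> \<eta> / 4" unfolding \<epsilon>_def by (rule min.cobounded1)
    moreover have "\<eta> * a / (4 * a) = \<eta> / 4" using a by simp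
    ultimately show ?thesis using R\<epsilon> aC by linarith
  qed
  have small: "\<bar>\<integral>w. inner (X w) (V w) \<partial>\<pi>\<bar> \<le> \<eta>"
    if "prob_space \<pi>" and [measurable]: "X \<in> borel_measurable \<pi>" "V \<in> borel_measurable \<pi>"
      and law: "distr \<pi> borel X = \<rho>" and \<rho>: "\<rho> \<in> P2"
      and V: "integrable \<pi> (\<lambda>w. (norm (V w))\<^sup>2)" "(\<integral>w. (norm (V w))\<^sup>2 \<partial>\<pi>) \<le> C2"
      and s: "s \<in> borel_measurable borel" "range s \<subseteq> E"
        "integrable \<rho> (\<lambda>x. (norm (x - s x))\<^sup>2)" "(\<integral>x. (norm (x - s x))\<^sup>2 \<partial>\<rho>) < \<eta> * a"
      and bad: "emeasure \<pi> {w \<in> space \<pi>. \<epsilon> < (\<Sum>e\<in>E. \<bar>inner e (V w)\<bar>)} \<le> ennreal \<epsilon>"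
    for \<pi> :: "(('h \<times> 'h) \<times> 'h) measure" and X V s \<rho>
  proof -
    interpret prob_space \<pi> by fact
    note [measurable] = s(1)
    have iX: "integrable \<pi> (\<lambda>w. (norm (X w))\<^sup>2)"
      using P2_distr[of \<pi> X] \<rho> law prob_space_axioms by simp
    have "integrable \<pi> (\<lambda>w. (norm (X w - s (X w)))\<^sup>2)"
      using s(3) unfolding law[symmetric] by (subst (asm) integrable_distr_eq) auto
    moreover have "(\<integral>w. (norm (X w - s (X w)))\<^sup>2 \<partial>\<pi>) \<le> \<eta> * a"
      using s(4) unfolding law[symmetric] by (subst (asm) integral_distr) auto
    ultimately have "\<bar>\<integral>w. inner (X w) (V w) \<partial>\<pi>\<bar> \<le> \<eta> * a / (4 * a) + 2 * a * C2 + \<epsilon> + R\<^sup>2 * \<epsilon> / (4 * a)"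
      unfolding R_def using iX V s E a \<epsilon> bad by (intro integral_inner_small[where s=s]) auto
    then show ?thesis using tot by linarith
  qed
  have V: "integrable \<pi> (\<lambda>w. (norm (snd w - snd (fst w)))\<^sup>2)"
      "(\<integral>w. (norm (snd w - snd (fst w)))\<^sup>2 \<partial>\<pi>) \<le> 2 * (\<integral>x. (norm x)\<^sup>2 \<partial>\<beta>) + 2 * (\<integral>x. (norm x)\<^sup>2 \<partial>\<alpha>)"
    if \<pi>: "prob_space \<pi>" "sets \<pi> = sets borel" "distr \<pi> borel fst = G" "distr \<pi> borel snd = \<beta>"
      and G: "G \<in> plans \<nu> \<alpha>" and P: "\<alpha> \<in> P2" "\<beta> \<in> P2"
    for \<pi> :: "(('h \<times> 'h) \<times> 'h) measure" and G \<alpha> \<beta>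
  proof -
    note c = plans_P2_components[OF \<pi> G]
    note [measurable] = c(1-4)
    have i: "integrable \<pi> (\<lambda>w. (norm (snd w))\<^sup>2)" "integrable \<pi> (\<lambda>w. (norm (snd (fst w)))\<^sup>2)"
      using P2_distr[OF \<pi>(1) c(3)] P2_distr[OF \<pi>(1) c(2)] c \<pi> P by auto
    show j: "integrable \<pi> (\<lambda>w. (norm (snd w - snd (fst w)))\<^sup>2)"
      by (intro integrable_norm_diff_sq i) measurable
    have "(\<integral>w. (norm (snd w - snd (fst w)))\<^sup>2 \<partial>\<pi>) \<le>
        (\<integral>w. 2 * (norm (snd w))\<^sup>2 + 2 * (norm (snd (fst w)))\<^sup>2 \<partial>\<pi>)"
      using i j by (intro integral_mono norm_diff_sq_le) auto
    also have "\<dots> = 2 * (\<integral>w. (norm (snd w))\<^sup>2 \<partial>\<pi>) + 2 * (\<integral>w. (norm (snd (fst w)))\<^sup>2 \<partial>\<pi>)"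
      using i by simp
    finally show "(\<integral>w. (norm (snd w - snd (fst w)))\<^sup>2 \<partial>\<pi>) \<le> 2 * (\<integral>x. (norm x)\<^sup>2 \<partial>\<beta>) + 2 * (\<integral>x. (norm x)\<^sup>2 \<partial>\<alpha>)"
      by (simp add: integral_norm_sq_distr[OF c(3)] integral_norm_sq_distr[OF c(2)] c \<pi>)
  qed
  have pm: "prob_space (\<mu> n)" "sets (\<mu> n) = sets borel" "prob_space \<mu>0" "sets \<mu>0 = sets borel" for n
    using \<mu>[of n] \<mu>0 by (auto simp: P2_def)
  show ?thesis
    using weak_coupling[OF pm conv E(1) \<epsilon>]
  proof eventually_elim
    case (elim n)
    then obtain h where h: "coupling_density (\<mu> n) \<mu>0 h" "coupling_density \<mu>0 (\<mu> n) (\<lambda>y z. h z y)"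
      "(\<integral>\<^sup>+z. \<integral>\<^sup>+y. h z y * indicator {(z, y). \<epsilon> < (\<Sum>e\<in>E. \<bar>inner e (y - z)\<bar>)} (z, y) \<partial>\<mu>0 \<partial>\<mu> n) \<le> ennreal \<epsilon>"
      "(\<integral>\<^sup>+y. \<integral>\<^sup>+z. h z y * indicator {(z, y). \<epsilon> < (\<Sum>e\<in>E. \<bar>inner e (y - z)\<bar>)} (y, z) \<partial>\<mu> n \<partial>\<mu>0) \<le> ennreal \<epsilon>"
      by blast
    have C2n: "2 * (\<integral>x. (norm x)\<^sup>2 \<partial>\<mu>0) + 2 * (\<integral>x. (norm x)\<^sup>2 \<partial>\<mu> n) \<le> C2"
      using bd[of n] by (simp add: C2_def)
    show ?case
    proof (intro conjI ballI)
      fix G assume G: "G \<in> plans \<nu> (\<mu> n)"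
      obtain \<pi> :: "(('h \<times> 'h) \<times> 'h) measure" where \<pi>: "prob_space \<pi>" "sets \<pi> = sets borel"
        "distr \<pi> borel fst = G" "distr \<pi> borel snd = \<mu>0"
        and b: "emeasure \<pi> {w \<in> space \<pi>. \<epsilon> < (\<Sum>e\<in>E. \<bar>inner e (snd w - snd (fst w))\<bar>)} \<le> ennreal \<epsilon>"
        by (rule glue_plan[OF G pm(3,4) h(1,3)])
      note c = plans_P2_components[OF \<pi> G]
      note [measurable] = c(1-4)
      note V = V[OF \<pi> G \<mu> \<mu>0]
      have "(\<integral>w. (norm (snd w - snd (fst w)))\<^sup>2 \<partial>\<pi>) \<le> C2" using V(2) C2n by linarith
      note sm = small[OF \<pi>(1) _ _ _ _ V(1) this _ _ _ _ b]
      have "\<bar>\<integral>w. inner (fst (fst w)) (snd w - snd (fst w)) \<partial>\<pi>\<bar> \<le> \<eta>"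
        by (rule sm[OF c(1) _ c(5) \<nu> s1(1) E(2) s1(3,4)]) measurable
      moreover have "\<bar>\<integral>w. inner (snd w) (snd w - snd (fst w)) \<partial>\<pi>\<bar> \<le> \<eta>"
        by (rule sm[OF c(3) _ \<pi>(4) \<mu>0 s2(1) E(3) s2(3,4)]) measurable
      ultimately show "\<exists>\<pi> :: (('h \<times> 'h) \<times> 'h) measure. prob_space \<pi> \<and> sets \<pi> = sets borel \<and>
       distr \<pi> borel fst = G \<and> distr \<pi> borel snd = \<mu>0 \<and>
       \<bar>\<integral>w. inner (fst (fst w)) (snd w - snd (fst w)) \<partial>\<pi>\<bar> \<le> \<eta> \<and>
       \<bar>\<integral>w. inner (snd w) (snd w - snd (fst w)) \<partial>\<pi>\<bar> \<le> \<eta>"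
        using \<pi> by blast
    next
      fix G assume G: "G \<in> plans \<nu> \<mu>0"
      obtain \<pi> :: "(('h \<times> 'h) \<times> 'h) measure" where \<pi>: "prob_space \<pi>" "sets \<pi> = sets borel"
        "distr \<pi> borel fst = G" "distr \<pi> borel snd = \<mu> n"
        and b: "emeasure \<pi> {w \<in> space \<pi>. \<epsilon> < (\<Sum>e\<in>E. \<bar>inner e (snd w - snd (fst w))\<bar>)} \<le> ennreal \<epsilon>"
        by (rule glue_plan[OF G pm(1,2) h(2,4)])
      note c = plans_P2_components[OF \<pi> G]
      note [measurable] = c(1-4)
      note V = V[OF \<pi> G \<mu>0 \<mu>]
      have "(\<integral>w. (norm (snd w - snd (fst w)))\<^sup>2 \<partial>\<pi>) \<le> C2" using V(2) C2n by linarith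
      note sm = small[OF \<pi>(1) _ _ _ _ V(1) this _ _ _ _ b]
      have "\<bar>\<integral>w. inner (fst (fst w)) (snd w - snd (fst w)) \<partial>\<pi>\<bar> \<le> \<eta>"
        by (rule sm[OF c(1) _ c(5) \<nu> s1(1) E(2) s1(3,4)]) measurable
      then show "\<exists>\<pi> :: (('h \<times> 'h) \<times> 'h) measure. prob_space \<pi> \<and> sets \<pi> = sets borel \<and>
       distr \<pi> borel fst = G \<and> distr \<pi> borel snd = \<mu> n \<and>
       \<bar>\<integral>w. inner (fst (fst w)) (snd w - snd (fst w)) \<partial>\<pi>\<bar> \<le> \<eta>"
        using \<pi> by blast
    qed
  qed
qed

section \<open>Interpolation towards the weak limit\<close>

text \<open>The threshold for \<open>n\<close> precedes \<open>G\<close>, so the optimal plan may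
  depend on \<open>n\<close>. Of the error \<open>8 * \<eta>\<close>, one half comes from the excess
  of the cost of \<open>(X, Y)\<close> over that of \<open>\<gamma>\<close>, the other from the
  mixed term of the expansion.\<close>

lemma transport_interpolation:
  fixes \<mu> :: "nat \<Rightarrow> 'h::{real_inner,second_countable_topology} measure"
  assumes \<mu>: "\<And>n. \<mu> n \<in> P2" and \<mu>0: "\<mu>0 \<in> P2" and \<nu>: "\<nu> \<in> P2"
    and conv: "narrow_conv_weak \<mu> \<mu>0" and bd: "\<And>n. (\<integral>x. (norm x)\<^sup>2 \<partial>\<mu> n) \<le> C"
    and \<eta>: "\<eta> > 0"
  shows "\<forall>\<^sub>F n in sequentially. \<forall>G \<in> optimal_plans \<nu> (\<mu> n). \<forall>\<gamma> \<in> plans \<nu> \<mu>0. \<forall>t \<in> {0..1}.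
    \<exists>\<Gamma> \<in> plans \<mu>0 (distr G borel (\<lambda>z. (1 - t) *\<^sub>R fst z + t *\<^sub>R snd z)).
      transport_cost \<Gamma> \<le> (1 - t)\<^sup>2 * transport_cost \<gamma> +
        t\<^sup>2 * (2 * C + 2 * (\<integral>x. (norm x)\<^sup>2 \<partial>\<mu>0)) + 8 * \<eta>"
  using weak_coupling_plans[OF \<mu> \<mu>0 \<nu> conv bd \<eta>]
proof eventually_elim
  case (elim n)
  show ?case
  proof (intro ballI)
    fix G \<gamma> and t :: real
    assume Go: "G \<in> optimal_plans \<nu> (\<mu> n)" and \<gamma>: "\<gamma> \<in> plans \<nu> \<mu>0" and t: "t \<in> {0..1}"
    define m0 where "m0 = (\<integral>x. (norm x)\<^sup>2 \<partial>\<mu>0)"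
    define mn where "mn = (\<integral>x. (norm x)\<^sup>2 \<partial>\<mu> n)"
    have G: "G \<in> plans \<nu> (\<mu> n)" and opt: "\<And>G'. G' \<in> plans \<nu> (\<mu> n) \<Longrightarrow> transport_cost G \<le> transport_cost G'"
      using Go by (auto simp: optimal_plans_def)
    obtain \<pi> :: "(('h \<times> 'h) \<times> 'h) measure" where \<pi>: "prob_space \<pi>" "sets \<pi> = sets borel"
        "distr \<pi> borel fst = G" "distr \<pi> borel snd = \<mu>0"
      and e1: "\<bar>\<integral>w. inner (fst (fst w)) (snd w - snd (fst w)) \<partial>\<pi>\<bar> \<le> \<eta>"
      and e1': "\<bar>\<integral>w. inner (snd w) (snd w - snd (fst w)) \<partial>\<pi>\<bar> \<le> \<eta>"
      using elim G by blast
    \<comment> \<open>Here \<open>\<gamma>\<close> is extended by a variable of law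
      \<open>\<mu> n\<close>, which yields a competitor for \<open>G\<close>.\<close>
    obtain \<pi>' :: "(('h \<times> 'h) \<times> 'h) measure" where \<pi>': "prob_space \<pi>'" "sets \<pi>' = sets borel"
        "distr \<pi>' borel fst = \<gamma>" "distr \<pi>' borel snd = \<mu> n"
      and e2: "\<bar>\<integral>w. inner (fst (fst w)) (snd w - snd (fst w)) \<partial>\<pi>'\<bar> \<le> \<eta>"
      using elim \<gamma> by blast
    note c = plans_P2_components[OF \<pi> G] and c' = plans_P2_components[OF \<pi>' \<gamma>]
    have i: "integrable \<pi> (\<lambda>w. (norm (fst (fst w)))\<^sup>2)" "integrable \<pi> (\<lambda>w. (norm (snd (fst w)))\<^sup>2)"
        "integrable \<pi> (\<lambda>w. (norm (snd w))\<^sup>2)"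
      using P2_distr[OF \<pi>(1) c(1)] P2_distr[OF \<pi>(1) c(2)] P2_distr[OF \<pi>(1) c(3)] c \<pi>(4) \<nu> \<mu>[of n] \<mu>0 by auto
    have i': "integrable \<pi>' (\<lambda>w. (norm (fst (fst w)))\<^sup>2)" "integrable \<pi>' (\<lambda>w. (norm (snd (fst w)))\<^sup>2)"
        "integrable \<pi>' (\<lambda>w. (norm (snd w))\<^sup>2)"
      using P2_distr[OF \<pi>'(1) c'(1)] P2_distr[OF \<pi>'(1) c'(2)] P2_distr[OF \<pi>'(1) c'(3)] c' \<pi>'(4) \<nu> \<mu>[of n] \<mu>0 by auto
    have mom: "(\<integral>w. (norm (snd w))\<^sup>2 \<partial>\<pi>) = m0" "(\<integral>w. (norm (snd (fst w)))\<^sup>2 \<partial>\<pi>) = mn"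
        "(\<integral>w. (norm (snd w))\<^sup>2 \<partial>\<pi>') = mn" "(\<integral>w. (norm (snd (fst w)))\<^sup>2 \<partial>\<pi>') = m0"
      by (simp_all add: m0_def mn_def integral_norm_sq_distr[OF c(3)] integral_norm_sq_distr[OF c(2)] c \<pi>(4)
           integral_norm_sq_distr[OF c'(3)] integral_norm_sq_distr[OF c'(2)] c' \<pi>'(4))
    have mcost: "(\<lambda>z::'h\<times>'h. (norm (fst z - snd z))\<^sup>2) \<in> borel_measurable borel"
      by (intro borel_measurable_continuous_onI continuous_intros)
    have cG: "transport_cost G = (\<integral>w. (norm (fst (fst w) - snd (fst w)))\<^sup>2 \<partial>\<pi>)"
      unfolding transport_cost_def \<pi>(3)[symmetric] by (rule integral_distr[OF c(4) mcost])
    have c\<gamma>: "transport_cost \<gamma> = (\<integral>w. (norm (fst (fst w) - snd (fst w)))\<^sup>2 \<partial>\<pi>')"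
      unfolding transport_cost_def \<pi>'(3)[symmetric] by (rule integral_distr[OF c'(4) mcost])
    \<comment> \<open>Under \<open>\<pi>'\<close> the first and third coordinates form a plan from
      \<open>\<nu>\<close> to \<open>\<mu> n\<close>; optimality of \<open>G\<close> enters
      here.\<close>
    have "transport_cost G \<le> (\<integral>w. (norm (fst (fst w) - snd w))\<^sup>2 \<partial>\<pi>')"
      using opt plan_of_joint_law[OF \<pi>'(1) c'(1) c'(3)] c' \<pi>'(4) by metis
    also have "\<dots> = transport_cost \<gamma> + mn - m0 - 2 * (\<integral>w. inner (fst (fst w)) (snd w - snd (fst w)) \<partial>\<pi>')"
      using integral_norm_sq_shift[OF c'(1) c'(2) c'(3) i'] by (simp add: c\<gamma> mom)
    finally have G_le: "transport_cost G \<le> transport_cost \<gamma> + mn - m0 + 2 * \<eta>" using e2 by linarith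
    \<comment> \<open>The same shift under \<open>\<pi>\<close> contributes \<open>m0 - mn\<close>,
      which cancels the \<open>mn - m0\<close> of \<open>G_le\<close>.\<close>
    have XY: "(\<integral>w. (norm (fst (fst w) - snd w))\<^sup>2 \<partial>\<pi>) \<le> transport_cost \<gamma> + 4 * \<eta>"
      using integral_norm_sq_shift[OF c(1) c(2) c(3) i] e1 G_le by (simp add: cG mom)
    have ii: "integrable \<pi> (\<lambda>w. (norm (fst (fst w) - snd w))\<^sup>2)"
        "integrable \<pi> (\<lambda>w. (norm (snd w - snd (fst w)))\<^sup>2)"
      by (intro integrable_norm_diff_sq i c)+
    have mV: "(\<lambda>w. snd w - snd (fst w)) \<in> borel_measurable \<pi>" by (intro borel_measurable_diff c)
    have ij: "integrable \<pi> (\<lambda>w. inner (fst (fst w)) (snd w - snd (fst w)))"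
        "integrable \<pi> (\<lambda>w. inner (snd w) (snd w - snd (fst w)))"
      by (intro integrable_inner i ii mV c)+
    have "(\<integral>w. (norm (snd w - snd (fst w)))\<^sup>2 \<partial>\<pi>) \<le> (\<integral>w. 2 * (norm (snd w))\<^sup>2 + 2 * (norm (snd (fst w)))\<^sup>2 \<partial>\<pi>)"
      using i ii by (intro integral_mono norm_diff_sq_le) auto
    also have "\<dots> = 2 * m0 + 2 * mn" using i by (simp add: mom)
    also have "\<dots> \<le> 2 * C + 2 * m0" using bd[of n] by (simp add: mn_def)
    finally have VV: "(\<integral>w. (norm (snd w - snd (fst w)))\<^sup>2 \<partial>\<pi>) \<le> 2 * C + 2 * m0" .
    let ?W = "\<lambda>w. (1 - t) *\<^sub>R fst (fst w) + t *\<^sub>R snd (fst w)"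
    have mW: "?W \<in> borel_measurable \<pi>"
      by (intro borel_measurable_add borel_measurable_scaleR c borel_measurable_const)
    have mI: "(\<lambda>z::'h\<times>'h. (1 - t) *\<^sub>R fst z + t *\<^sub>R snd z) \<in> borel_measurable borel"
      by (intro borel_measurable_continuous_onI continuous_intros)
    have dW: "distr \<pi> borel ?W = distr G borel (\<lambda>z. (1 - t) *\<^sub>R fst z + t *\<^sub>R snd z)"
      unfolding \<pi>(3)[symmetric] by (subst distr_distr[OF mI c(4)]) (simp add: comp_def)
    \<comment> \<open>The mixed term is the inner product of \<open>Y - X\<close> with
      \<open>Y - Z\<close>; it splits into exactly the two products that \<open>\<pi>\<close> keeps
      small.\<close>
    have pw: "(norm (snd w - ?W w))\<^sup>2 = (1 - t)\<^sup>2 * (norm (fst (fst w) - snd w))\<^sup>2 +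
        t\<^sup>2 * (norm (snd w - snd (fst w)))\<^sup>2 +
        2 * t * (1 - t) * (inner (snd w) (snd w - snd (fst w)) - inner (fst (fst w)) (snd w - snd (fst w)))"
      for w :: "('h \<times> 'h) \<times> 'h"
    proof -
      have "snd w - ?W w = (1 - t) *\<^sub>R (snd w - fst (fst w)) + t *\<^sub>R (snd w - snd (fst w))"
        by (simp add: algebra_simps)
      then have "(norm (snd w - ?W w))\<^sup>2 = (1 - t)\<^sup>2 * (norm (snd w - fst (fst w)))\<^sup>2 +
          t\<^sup>2 * (norm (snd w - snd (fst w)))\<^sup>2 +
          2 * t * (1 - t) * inner (snd w - fst (fst w)) (snd w - snd (fst w))"
        by (simp only: power2_norm_eq_inner inner_add_left inner_add_right inner_scaleR_left inner_scaleR_right)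
           (simp add: inner_commute power2_eq_square algebra_simps)
      then show ?thesis by (simp add: norm_minus_commute inner_diff_left)
    qed
    have "(\<integral>w. (norm (snd w - ?W w))\<^sup>2 \<partial>\<pi>) = (1 - t)\<^sup>2 * (\<integral>w. (norm (fst (fst w) - snd w))\<^sup>2 \<partial>\<pi>) +
        t\<^sup>2 * (\<integral>w. (norm (snd w - snd (fst w)))\<^sup>2 \<partial>\<pi>) +
        2 * t * (1 - t) * ((\<integral>w. inner (snd w) (snd w - snd (fst w)) \<partial>\<pi>) -
          (\<integral>w. inner (fst (fst w)) (snd w - snd (fst w)) \<partial>\<pi>))"
      unfolding pw using ii ij by simp
    also have "\<dots> \<le> (1 - t)\<^sup>2 * (transport_cost \<gamma> + 4 * \<eta>) + t\<^sup>2 * (2 * C + 2 * m0) + 2 * t * (1 - t) * (2 * \<eta>)"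
      using XY VV e1 e1' t by (intro add_mono mult_left_mono) auto
    also have "\<dots> \<le> (1 - t)\<^sup>2 * transport_cost \<gamma> + t\<^sup>2 * (2 * C + 2 * m0) + 8 * \<eta>"
    proof -
      have "(1 - t)\<^sup>2 \<le> 1" "t * (1 - t) \<le> 1" using t by (auto intro: power_le_one mult_le_one)
      then have "(1 - t)\<^sup>2 * \<eta> \<le> 1 * \<eta>" "t * (1 - t) * \<eta> \<le> 1 * \<eta>"
        using \<eta> by (intro mult_right_mono; simp)+
      then show ?thesis by (simp add: distrib_left)
    qed
    finally have "(\<integral>w. (norm (snd w - ?W w))\<^sup>2 \<partial>\<pi>) \<le> (1 - t)\<^sup>2 * transport_cost \<gamma> + t\<^sup>2 * (2 * C + 2 * m0) + 8 * \<eta>" .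
    then show "\<exists>\<Gamma> \<in> plans \<mu>0 (distr G borel (\<lambda>z. (1 - t) *\<^sub>R fst z + t *\<^sub>R snd z)).
      transport_cost \<Gamma> \<le> (1 - t)\<^sup>2 * transport_cost \<gamma> +
        t\<^sup>2 * (2 * C + 2 * (\<integral>x. (norm x)\<^sup>2 \<partial>\<mu>0)) + 8 * \<eta>"
      using plan_of_joint_law[OF \<pi>(1) c(3) mW] unfolding \<pi>(4) dW m0_def
      by (intro bexI[of _ "distr \<pi> borel (\<lambda>w. (snd w, ?W w))"]) auto
  qed
qed

section \<open>Elementary facts on plans, \<open>W2\<close> and interpolants\<close>

lemma plans_flip:
  fixes \<mu> \<nu> :: "'h::{real_inner,second_countable_topology} measure"
  assumes "G \<in> plans \<mu> \<nu>"
  shows "\<exists>G' \<in> plans \<nu> \<mu>. transport_cost G' = transport_cost G"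
proof -
  have G: "prob_space G" "sets G = sets borel" "distr G borel fst = \<mu>" "distr G borel snd = \<nu>"
    using assms by (auto simp: plans_def)
  have m: "fst \<in> borel_measurable G" "snd \<in> borel_measurable G"
    unfolding measurable_cong_sets[OF G(2) refl] by (rule borel_measurable_fst_snd)+
  show ?thesis
    using plan_of_joint_law[OF G(1) m(2) m(1)] G(3,4)
    by (intro bexI[of _ "distr G borel (\<lambda>w. (snd w, fst w))"])
       (auto simp: transport_cost_def norm_minus_commute)
qed

lemma plans_nonempty:
  fixes \<mu> \<nu> :: "'h::{real_inner,second_countable_topology} measure"
  assumes "\<mu> \<in> P2" "\<nu> \<in> P2"
  shows "plans \<mu> \<nu> \<noteq> {}"
proof -
  have p: "prob_space \<mu>" "prob_space \<nu>" and s: "sets \<mu> = sets borel" "sets \<nu> = sets borel"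
    using assms by (auto simp: P2_def)
  interpret A: prob_space \<mu> by fact
  interpret B: prob_space \<nu> by fact
  interpret pair_prob_space \<mu> \<nu> ..
  have f: "fst \<in> borel_measurable (\<mu> \<Otimes>\<^sub>M \<nu>)" "snd \<in> borel_measurable (\<mu> \<Otimes>\<^sub>M \<nu>)"
    using measurable_fst[of \<mu> \<nu>] measurable_snd[of \<mu> \<nu>] s by (auto cong: measurable_cong_sets)
  have "distr (\<mu> \<Otimes>\<^sub>M \<nu>) borel fst = distr (\<mu> \<Otimes>\<^sub>M \<nu>) \<mu> fst" "distr (\<mu> \<Otimes>\<^sub>M \<nu>) borel snd = distr (\<mu> \<Otimes>\<^sub>M \<nu>) \<nu> snd"
    by (intro distr_cong; simp add: s)+
  moreover have "distr (\<mu> \<Otimes>\<^sub>M \<nu>) \<mu> fst = \<mu>"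
    by (rule B.distr_pair_fst)
  moreover have "distr (\<mu> \<Otimes>\<^sub>M \<nu>) \<nu> snd = \<nu>"
  proof (rule measure_eqI)
    fix X assume "X \<in> sets (distr (\<mu> \<Otimes>\<^sub>M \<nu>) \<nu> snd)"
    then have X: "X \<in> sets \<nu>" by simp
    have "emeasure (distr (\<mu> \<Otimes>\<^sub>M \<nu>) \<nu> snd) X = emeasure (\<mu> \<Otimes>\<^sub>M \<nu>) (space \<mu> \<times> X)"
      using X sets.sets_into_space[OF X]
      by (subst emeasure_distr) (auto simp: space_pair_measure intro!: arg_cong[where f="emeasure (\<mu> \<Otimes>\<^sub>M \<nu>)"])
    then show "emeasure (distr (\<mu> \<Otimes>\<^sub>M \<nu>) \<nu> snd) X = emeasure \<nu> X"
      using X by (simp add: B.emeasure_pair_measure_Times A.emeasure_space_1)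
  qed simp
  ultimately show ?thesis
    using plan_of_joint_law(1)[OF prob_space_axioms f] by auto
qed

lemma W2_less:
  assumes "\<Gamma> \<in> plans \<mu> \<nu>" "transport_cost \<Gamma> < \<delta>\<^sup>2" "\<delta> > 0"
  shows "W2 \<mu> \<nu> < \<delta>"
proof -
  have "bdd_below (transport_cost ` plans \<mu> \<nu>)"
    by (rule bdd_belowI[of _ 0]) (auto simp: transport_cost_def)
  then have "(INF G\<in>plans \<mu> \<nu>. transport_cost G) \<le> transport_cost \<Gamma>"
    using assms(1) by (rule cINF_lower)
  then have "(INF G\<in>plans \<mu> \<nu>. transport_cost G) < \<delta>\<^sup>2" using assms(2) by linarith
  then show ?thesis unfolding W2_def using assms(3) real_sqrt_less_mono by fastforce
qed

lemma interpolant_P2: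
  fixes \<mu> \<nu> :: "'h::{real_inner,second_countable_topology} measure"
  assumes G: "G \<in> plans \<mu> \<nu>" and P: "\<mu> \<in> P2" "\<nu> \<in> P2"
  shows "distr G borel (\<lambda>z. (1 - t) *\<^sub>R fst z + t *\<^sub>R snd z) \<in> P2"
proof -
  have G: "prob_space G" "sets G = sets borel" "distr G borel fst = \<mu>" "distr G borel snd = \<nu>"
    using assms by (auto simp: plans_def)
  have m [measurable]: "fst \<in> borel_measurable G" "snd \<in> borel_measurable G"
    unfolding measurable_cong_sets[OF G(2) refl] by (rule borel_measurable_fst_snd)+
  have i: "integrable G (\<lambda>w. (norm (fst w))\<^sup>2)" "integrable G (\<lambda>w. (norm (snd w))\<^sup>2)"
    using P2_distr[OF G(1) m(1)] P2_distr[OF G(1) m(2)] G P by auto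
  \<comment> \<open>Written as a difference with coefficient \<open>- t\<close> to fit
    \<open>integrable_norm_diff_sq\<close>.\<close>
  have "integrable G (\<lambda>w. (norm ((1 - t) *\<^sub>R fst w - (- t) *\<^sub>R snd w))\<^sup>2)"
    by (intro integrable_norm_diff_sq) (use i in \<open>auto simp: power_mult_distrib\<close>)
  then show ?thesis by (subst P2_distr[OF G(1)]) auto
qed

text \<open>A short geodesic step from an almost nearest point of a sublevel set stays in the set by
  convexity. It gains to first order in \<open>t\<close> and loses only to second order, so it
  undercuts the infimum \<open>d\<close>.\<close>

lemma narrow_lsc:
  fixes \<phi> :: "'h::{real_inner,second_countable_topology} measure \<Rightarrow> ereal" and \<mu>0 :: "'h measure"
  assumes convex: "geodesically_convex \<phi>" and lsc: "W2_lsc \<phi>"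
    and \<mu>: "\<And>n. \<mu> n \<in> P2" and \<mu>0: "\<mu>0 \<in> P2" and conv: "narrow_conv_weak \<mu> \<mu>0"
    and bd: "\<And>n. (\<integral>x. (norm x)\<^sup>2 \<partial>\<mu> n) \<le> C"
  shows "\<phi> \<mu>0 \<le> liminf (\<lambda>n. \<phi> (\<mu> n))"
proof (rule ccontr)
  assume "\<not> ?thesis"
  then have "liminf (\<lambda>n. \<phi> (\<mu> n)) < \<phi> \<mu>0" by simp
  then obtain c :: real where c: "liminf (\<lambda>n. \<phi> (\<mu> n)) < ereal c" "ereal c < \<phi> \<mu>0"
    using ereal_dense2[of "liminf (\<lambda>n. \<phi> (\<mu> n))" "\<phi> \<mu>0"] by auto
  have freq: "\<exists>\<^sub>F n in sequentially. \<phi> (\<mu> n) \<le> ereal c"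
  proof (rule ccontr)
    assume "\<not> ?thesis"
    then have "\<forall>\<^sub>F n in sequentially. ereal c \<le> \<phi> (\<mu> n)"
      by (simp add: not_frequently) (auto elim: eventually_mono)
    then have "ereal c \<le> liminf (\<lambda>n. \<phi> (\<mu> n))" by (rule Liminf_bounded)
    then show False using c by simp
  qed
  obtain \<delta> where \<delta>: "\<delta> > 0" "\<And>N. N \<in> P2 \<Longrightarrow> W2 \<mu>0 N < \<delta> \<Longrightarrow> ereal c < \<phi> N"
    using lsc \<mu>0 c(2) unfolding W2_lsc_def by blast
  define K where "K = {N \<in> P2. \<phi> N \<le> ereal c}"
  \<comment> \<open>All costs are collected, not only optimal ones; the infimum is still the squared
    distance from \<open>\<mu>0\<close> to \<open>K\<close>.\<close>
  define A where "A = {transport_cost \<Gamma> | \<Gamma> N. N \<in> K \<and> \<Gamma> \<in> plans \<mu>0 N}"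
  define d where "d = Inf A"
  \<comment> \<open>Lower semicontinuity in \<open>W2\<close> keeps \<open>K\<close> out of the ball
    of radius \<open>\<delta>\<close> around \<open>\<mu>0\<close>, which will make \<open>d\<close>
    positive.\<close>
  have A_ge: "\<delta>\<^sup>2 \<le> r" if rA: "r \<in> A" for r
  proof (rule ccontr)
    assume r: "\<not> \<delta>\<^sup>2 \<le> r"
    obtain \<Gamma> N where N: "r = transport_cost \<Gamma>" "N \<in> K" "\<Gamma> \<in> plans \<mu>0 N" using rA by (auto simp: A_def)
    then have "W2 \<mu>0 N < \<delta>" using r \<delta>(1) by (intro W2_less[of \<Gamma>]) auto
    then show False using \<delta>(2)[of N] N(2) by (auto simp: K_def)
  qed
  have "\<exists>n. \<mu> n \<in> K" using frequently_ex[OF freq] \<mu> by (auto simp: K_def)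
  then have Ane: "A \<noteq> {}" using plans_nonempty[OF \<mu>0] by (fastforce simp: A_def K_def)
  have Abdd: "bdd_below A" by (rule bdd_belowI[of _ "\<delta>\<^sup>2"]) (rule A_ge)
  have "\<delta>\<^sup>2 \<le> d" unfolding d_def by (rule cInf_greatest[OF Ane A_ge])
  moreover have "\<delta>\<^sup>2 > 0" using \<delta>(1) by simp
  ultimately have d: "d > 0" by linarith
  define C2 where "C2 = 2 * C + 2 * (\<integral>x. (norm x)\<^sup>2 \<partial>\<mu>0)"
  have "0 \<le> (\<integral>x. (norm x)\<^sup>2 \<partial>\<mu> 0)" "0 \<le> (\<integral>x. (norm x)\<^sup>2 \<partial>\<mu>0)" by auto
  then have C2: "C2 \<ge> 0" using bd[of 0] unfolding C2_def by linarith
  \<comment> \<open>Small enough that the loss \<open>t\<^sup>2 * C2\<close> is at most half of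
    \<open>t * d\<close>.\<close>
  define t where "t = d / (2 * (C2 + d))"
  have t: "t > 0" "t \<le> 1" "t * C2 \<le> d / 2" using d C2 by (auto simp: t_def field_simps)
  \<comment> \<open>The errors add up to at most \<open>9 * \<eta>\<close>, that is
    \<open>t * d / 4\<close>, less than the remaining gain \<open>t * d / 2\<close>.\<close>
  define \<eta> where "\<eta> = t * d / 36"
  have \<eta>: "\<eta> > 0" using t d by (simp add: \<eta>_def)
  \<comment> \<open>An almost nearest point \<open>\<nu>\<close> of \<open>K\<close>; the infimum
    may fail to be attained.\<close>
  obtain r where r: "r \<in> A" "r < d + \<eta>"
    using cInf_lessD[OF Ane, of "d + \<eta>"] \<eta> by (auto simp: d_def)
  then obtain \<Gamma> \<nu> where \<nu>: "\<nu> \<in> K" "\<Gamma> \<in> plans \<mu>0 \<nu>" "r = transport_cost \<Gamma>" by (auto simp: A_def)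
  obtain \<gamma> where \<gamma>: "\<gamma> \<in> plans \<nu> \<mu>0" "transport_cost \<gamma> < d + \<eta>"
    using plans_flip[OF \<nu>(2)] \<nu>(3) r(2) by auto
  have \<nu>P: "\<nu> \<in> P2" using \<nu>(1) by (simp add: K_def)
  \<comment> \<open>A frequent and an eventual property meet at one index, so no subsequence is
    extracted.\<close>
  obtain n where n: "\<phi> (\<mu> n) \<le> ereal c"
    "\<forall>G \<in> optimal_plans \<nu> (\<mu> n). \<forall>\<gamma> \<in> plans \<nu> \<mu>0. \<forall>t \<in> {0..1}.
      \<exists>\<Gamma> \<in> plans \<mu>0 (distr G borel (\<lambda>z. (1 - t) *\<^sub>R fst z + t *\<^sub>R snd z)).
      transport_cost \<Gamma> \<le> (1 - t)\<^sup>2 * transport_cost \<gamma> +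
        t\<^sup>2 * (2 * C + 2 * (\<integral>x. (norm x)\<^sup>2 \<partial>\<mu>0)) + 8 * \<eta>"
    using frequently_ex[OF frequently_eventually_conj[OF freq transport_interpolation[OF \<mu> \<mu>0 \<nu>P conv bd \<eta>]]]
    by blast
  have "\<nu> \<in> proper_domain \<phi>" "\<mu> n \<in> proper_domain \<phi>"
    using \<nu>(1) n(1) \<mu> by (auto simp: K_def proper_domain_def le_less_trans)
  then obtain G where G: "G \<in> optimal_plans \<nu> (\<mu> n)"
    "\<And>s. s \<in> {0..1} \<Longrightarrow> \<phi> (distr G borel (\<lambda>z. (1 - s) *\<^sub>R fst z + s *\<^sub>R snd z))
                        \<le> ereal (1 - s) * \<phi> \<nu> + ereal s * \<phi> (\<mu> n)"
    using convex unfolding geodesically_convex_def by blast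
  define N where "N = distr G borel (\<lambda>z. (1 - t) *\<^sub>R fst z + t *\<^sub>R snd z)"
  have "N \<in> P2" unfolding N_def
    using G(1) by (intro interpolant_P2[OF _ \<nu>P \<mu>]) (auto simp: optimal_plans_def)
  moreover have "\<phi> N \<le> ereal c"
  proof -
    have "\<phi> N \<le> ereal (1 - t) * \<phi> \<nu> + ereal t * \<phi> (\<mu> n)"
      unfolding N_def by (rule G(2)) (use t in auto)
    also have "\<dots> \<le> ereal (1 - t) * ereal c + ereal t * ereal c"
      using \<nu>(1) n(1) t by (intro add_mono ereal_mult_left_mono) (auto simp: K_def)
    also have "\<dots> = ereal c" by (simp add: algebra_simps)
    finally show ?thesis .
  qed
  ultimately have NK: "N \<in> K" by (simp add: K_def)
  obtain \<Gamma>' where \<Gamma>': "\<Gamma>' \<in> plans \<mu>0 N"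
    "transport_cost \<Gamma>' \<le> (1 - t)\<^sup>2 * transport_cost \<gamma> + t\<^sup>2 * C2 + 8 * \<eta>"
    using n(2) G(1) \<gamma>(1) t unfolding N_def C2_def by (meson atLeastAtMost_iff less_imp_le)
  have "d \<le> transport_cost \<Gamma>'"
    unfolding d_def using NK \<Gamma>'(1) by (intro cInf_lower Abdd) (auto simp: A_def)
  also have "\<dots> \<le> (1 - t)\<^sup>2 * (d + \<eta>) + t\<^sup>2 * C2 + 8 * \<eta>"
    using \<Gamma>'(2) mult_left_mono[OF less_imp_le[OF \<gamma>(2)], of "(1 - t)\<^sup>2"] by simp
  also have "\<dots> \<le> (1 - t) * (d + \<eta>) + t * (d / 2) + 8 * \<eta>"
  proof -
    have "(1 - t)\<^sup>2 * (d + \<eta>) \<le> (1 - t) * (d + \<eta>)"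
      using t d \<eta> by (intro mult_right_mono) (auto simp: power2_eq_square mult_left_le)
    moreover have "t\<^sup>2 * C2 \<le> t * (d / 2)"
      using mult_left_mono[OF t(3), of t] t(1) by (simp add: power2_eq_square mult.assoc)
    ultimately show ?thesis by linarith
  qed
  also have "\<dots> = d - t * d / 2 + 9 * \<eta> - t * \<eta>" by (simp add: algebra_simps)
  also have "\<dots> \<le> d - t * d / 2 + t * d / 4" using t \<eta> by (simp add: \<eta>_def)
  also have "\<dots> < d" using t d by simp
  finally show False by simp
qed

section \<open>Convergence in the weak topology of the Wasserstein space\<close>

lemma inner_sgn_self: "inner (sgn x) x = norm x" for x :: "'a::real_inner"
  by (cases "x = 0") (simp_all add: sgn_div_norm power2_norm_eq_inner[symmetric] power2_eq_square)

text \<open>Uniform boundedness principle: the closed sets \<open>F N\<close> cover the complete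
  space because every \<open>inner e (x n)\<close> converges, so by Baire one of them contains a
  ball.\<close>

lemma weakly_convergent_bounded:
  fixes x :: "nat \<Rightarrow> 'h::{real_inner,complete_space}"
  assumes "limitin weak_topology x l sequentially"
  shows "\<exists>B. \<forall>n. norm (x n) \<le> B"
proof -
  define F where "F N = {e::'h. \<forall>n. \<bar>inner e (x n)\<bar> \<le> real N}" for N :: nat
  have clF: "closed (F N)" for N
  proof -
    have "F N = (\<Inter>n. {e. \<bar>inner e (x n)\<bar> \<le> real N})" by (auto simp: F_def)
    moreover have "closed {e. \<bar>inner e (x n)\<bar> \<le> real N}" for n
      by (intro closed_Collect_le continuous_intros)
    ultimately show ?thesis by auto
  qed
  have "\<exists>N. e \<in> F N" for e
  proof -
    have "(\<lambda>n. inner e (x n)) \<longlonglongrightarrow> inner e l"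
      using continuous_map_limit[OF continuous_map_weak_inner[of e] assms] by (simp add: comp_def)
    then have "Bseq (\<lambda>n. inner e (x n))" using convergentI convergent_imp_Bseq by blast
    then obtain K where K: "\<And>n. \<bar>inner e (x n)\<bar> \<le> K" by (auto simp: Bseq_def)
    obtain N :: nat where "K \<le> real N" using real_arch_simple by blast
    then have "e \<in> F N" using K by (fastforce simp: F_def intro: order_trans)
    then show ?thesis ..
  qed
  then have "\<Union>(range F) = UNIV" by blast
  moreover have "interior (\<Union>(range F)) = {}" if "\<And>N. interior (F N) = {}"
  proof -
    have "euclidean interior_of (\<Union>(range F)) = {}"
      by (rule Baire_category_alt) (use that clF completely_metrizable_space_euclidean in auto)
    then show ?thesis by simp
  qed
  ultimately obtain N e0 where "e0 \<in> interior (F N)" by fastforce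
  then obtain r where r: "r > 0" "ball e0 r \<subseteq> F N" by (auto simp: mem_interior)
  have "norm (x n) \<le> 4 * real N / r" for n
  proof -
    \<comment> \<open>Moving from the centre in the direction of \<open>x n\<close> stays in the
      ball and reads off the norm of \<open>x n\<close>.\<close>
    define v where "v = (r / 2) *\<^sub>R sgn (x n)"
    have "norm v \<le> r / 2" using r(1) by (simp add: v_def norm_sgn)
    then have "e0 + v \<in> F N" "e0 \<in> F N" using r by (auto simp: dist_norm)
    then have "\<bar>inner (e0 + v) (x n)\<bar> \<le> N" "\<bar>inner e0 (x n)\<bar> \<le> N" by (auto simp: F_def)
    then have "inner v (x n) \<le> 2 * N" by (simp add: inner_add_left)
    moreover have "inner v (x n) = r / 2 * norm (x n)"
      by (simp add: v_def inner_sgn_self)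
    ultimately show ?thesis using r(1) by (simp add: field_simps)
  qed
  then show ?thesis by blast
qed

lemma subquadratic_tendsto_0:
  fixes f :: "'h::real_normed_vector \<Rightarrow> real"
  assumes "\<And>\<epsilon>. \<epsilon> > 0 \<Longrightarrow> \<exists>B. \<forall>x. \<bar>f x\<bar> \<le> \<epsilon> * (norm x)\<^sup>2 + B"
  shows "((\<lambda>x. f x / (1 + (norm x)\<^sup>2)) \<longlongrightarrow> 0) at_infinity"
proof (rule tendstoI)
  fix \<epsilon> :: real assume \<epsilon>: "\<epsilon> > 0"
  then obtain B where B: "\<And>x. \<bar>f x\<bar> \<le> \<epsilon> / 2 * (norm x)\<^sup>2 + B" using assms[of "\<epsilon> / 2"] by auto
  \<comment> \<open>As \<open>b\<close> is at least 1, \<open>norm x \<ge> b\<close> gives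
    \<open>(norm x)\<^sup>2 \<ge> b\<close>, hence
    \<open>2 * \<bar>B\<bar> \<le> \<epsilon> * (norm x)\<^sup>2\<close>.\<close>
  define b where "b = max 1 (2 * \<bar>B\<bar> / \<epsilon>)"
  have "dist (f x / (1 + (norm x)\<^sup>2)) 0 < \<epsilon>" if "b \<le> norm x" for x
  proof -
    have b: "1 \<le> b" "2 * \<bar>B\<bar> \<le> \<epsilon> * b" using \<epsilon> by (auto simp: b_def max_def field_simps)
    have "b * 1 \<le> norm x * norm x" using that b by (intro mult_mono) auto
    then have "\<epsilon> * b \<le> \<epsilon> * (norm x)\<^sup>2" using \<epsilon> by (simp add: power2_eq_square)
    then have "2 * \<bar>f x\<bar> \<le> 2 * (\<epsilon> * (norm x)\<^sup>2)" using B[of x] b(2) by linarith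
    then have "\<bar>f x\<bar> < \<epsilon> * (1 + (norm x)\<^sup>2)" using \<epsilon> by (simp add: distrib_left)
    moreover have "1 + (norm x)\<^sup>2 > 0" by (simp add: add_pos_nonneg)
    ultimately show ?thesis by (simp add: divide_less_eq)
  qed
  then show "\<forall>\<^sub>F x in at_infinity. dist (f x / (1 + (norm x)\<^sup>2)) 0 < \<epsilon>"
    by (auto simp: eventually_at_infinity)
qed

lemma weakly_continuous_imp_seq:
  assumes "continuous_map weak_topology euclideanreal f"
  shows "seq_weakly_continuous f"
  using continuous_map_limit[OF assms] by (auto simp: seq_weakly_continuous_def comp_def)

lemma P2w_limit_integral:
  assumes lim: "limitin P2w_topology \<sigma> l sequentially" and f: "f \<in> P2w_test_functions"
  shows "(\<lambda>n. \<integral>x. f x \<partial>\<sigma> n) \<longlonglongrightarrow> (\<integral>x. f x \<partial>l)"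
proof (rule topological_tendstoI)
  fix S :: "real set" assume S: "open S" "(\<integral>x. f x \<partial>l) \<in> S"
  have l: "l \<in> P2" using lim by (simp add: limitin_def)
  have "openin P2w_topology {M \<in> P2. (\<integral>x. f x \<partial>M) \<in> S}"
    unfolding P2w_topology_def by (rule topology_generated_by_Basis) (use f S(1) in blast)
  then have "\<forall>\<^sub>F n in sequentially. \<sigma> n \<in> {M \<in> P2. (\<integral>x. f x \<partial>M) \<in> S}"
    using lim S(2) l unfolding limitin_def by blast
  then show "\<forall>\<^sub>F n in sequentially. (\<integral>x. f x \<partial>\<sigma> n) \<in> S" by (rule eventually_mono) auto
qed

text \<open>Bounded weakly continuous functions are subquadratic and sequentially weakly continuous,
  hence test functions.\<close>

lemma P2w_limit_narrow:
  assumes lim: "limitin P2w_topology \<sigma> l sequentially"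
  shows "narrow_conv_weak \<sigma> l"
  unfolding narrow_conv_weak_def
proof (intro allI impI, elim conjE)
  fix f :: "'a \<Rightarrow> real"
  assume f: "continuous_map weak_topology euclideanreal f" "bounded (range f)"
  obtain B where "\<And>x. \<bar>f x\<bar> \<le> B" using f(2) by (auto simp: bounded_iff)
  then have "\<bar>f x\<bar> \<le> \<epsilon> * (norm x)\<^sup>2 + B" if "\<epsilon> > 0" for \<epsilon> x
    using that by (simp add: add_increasing)
  then have "((\<lambda>x. f x / (1 + (norm x)\<^sup>2)) \<longlongrightarrow> 0) at_infinity"
    by (intro subquadratic_tendsto_0) blast
  then show "(\<lambda>n. \<integral>x. f x \<partial>\<sigma> n) \<longlonglongrightarrow> (\<integral>x. f x \<partial>l)"
    using weakly_continuous_imp_seq[OF f(1)] by (intro P2w_limit_integral[OF lim]) (simp add: P2w_test_functions_def)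
qed

text \<open>By separability the norm is a countable supremum of absolute values of unit functionals;
  \<open>q m\<close> is the maximum over the first \<open>m\<close>.\<close>

lemma weakly_continuous_norm_approx:
  obtains q :: "nat \<Rightarrow> 'h::{real_inner,second_countable_topology} \<Rightarrow> real" where
    "\<And>m. continuous_map weak_topology euclideanreal (q m)" "\<And>m. q m \<in> borel_measurable borel"
    "\<And>m x. 0 \<le> q m x" "\<And>m x. q m x \<le> norm x" "\<And>x. (\<lambda>m. q m x) \<longlonglongrightarrow> norm x"
proof -
  obtain D :: "'h set" where D: "countable D" "\<And>X. open X \<Longrightarrow> X \<noteq> {} \<Longrightarrow> \<exists>d\<in>D. d \<in> X"
    using countable_dense_exists[where 'a='h] by auto
  define u where "u i = sgn (from_nat_into D i)" for i
  define q where "q = rec_nat (\<lambda>x::'h. 0::real) (\<lambda>m r x. max (r x) \<bar>inner (u m) x\<bar>)"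
  have q0: "q 0 = (\<lambda>x. 0)" and qS: "q (Suc m) = (\<lambda>x. max (q m x) \<bar>inner (u m) x\<bar>)" for m
    by (simp_all add: q_def)
  have c: "continuous_map weak_topology euclideanreal (q m)" for m
    by (induction m)
       (auto simp: q0 qS intro!: continuous_map_real_max continuous_map_real_abs continuous_map_weak_inner)
  have meas: "q m \<in> borel_measurable borel" for m
    by (induction m) (auto simp: q0 qS)
  have nonneg: "0 \<le> q m x" for m x by (induction m) (auto simp: q0 qS)
  have le: "q m x \<le> norm x" for m x
  proof (induction m)
    case (Suc m)
    have "\<bar>inner (u m) x\<bar> \<le> norm (u m) * norm x" by (rule Cauchy_Schwarz_ineq2)
    also have "\<dots> \<le> 1 * norm x" by (intro mult_right_mono) (auto simp: u_def norm_sgn)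
    finally show ?case using Suc by (simp add: qS)
  qed (simp add: q0)
  have mono: "q m x \<le> q (m + k) x" for m k x by (induction k) (auto simp: qS max_def)
  have lim: "(\<lambda>m. q m x) \<longlonglongrightarrow> norm x" for x
  proof (rule tendstoI)
    fix \<epsilon> :: real assume \<epsilon>: "\<epsilon> > 0"
    then obtain d where d: "d \<in> D" "dist x d < \<epsilon> / 2"
      using D(2)[of "ball x (\<epsilon> / 2)"] by auto
    then obtain i where i: "from_nat_into D i = d" using from_nat_into_surj[OF D(1)] by metis
    \<comment> \<open>The direction of a point \<open>d\<close> near \<open>x\<close> almost
      realises the norm of \<open>x\<close>.\<close>
    have "norm x - \<epsilon> < inner (sgn d) x"
    proof -
      have "inner (sgn d) d = norm d" by (rule inner_sgn_self)
      moreover have "\<bar>inner (sgn d) (x - d)\<bar> \<le> norm (sgn d) * norm (x - d)" by (rule Cauchy_Schwarz_ineq2)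
      moreover have "norm (sgn d) * norm (x - d) \<le> 1 * norm (x - d)"
        by (intro mult_right_mono) (auto simp: norm_sgn)
      moreover have "norm x \<le> norm d + norm (x - d)" using norm_triangle_ineq[of d "x - d"] by simp
      ultimately show ?thesis using d(2) by (simp add: inner_diff_right dist_norm)
    qed
    then have qi: "norm x - \<epsilon> < q (Suc i) x" by (simp add: qS u_def i)
    have "dist (q m x) (norm x) < \<epsilon>" if "Suc i \<le> m" for m
      using mono[of "Suc i" x "m - Suc i"] that qi le[of m x] \<epsilon> by (simp add: dist_real_def)
    then show "\<forall>\<^sub>F m in sequentially. dist (q m x) (norm x) < \<epsilon>"
      by (auto simp: eventually_sequentially)
  qed
  show ?thesis by (rule that[of q]) (use c meas nonneg le lim in auto)
qed

text \<open>Squares of the weakly continuous norm approximations, truncated at a finite level,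
  recover the second moment by dominated convergence.\<close>

lemma second_moment_weak_lower_bound:
  fixes M :: "'h::{real_inner,second_countable_topology} measure"
  assumes M: "M \<in> P2" and c: "c < (\<integral>x. (norm x)\<^sup>2 \<partial>M)"
  obtains g :: "'h \<Rightarrow> real" and T where
    "continuous_map weak_topology euclideanreal g" "g \<in> borel_measurable borel"
    "\<And>x. 0 \<le> g x" "\<And>x. g x \<le> (norm x)\<^sup>2" "\<And>x. g x \<le> T" "c < (\<integral>x. g x \<partial>M)"
proof -
  have sM [measurable_cong]: "sets M = sets borel" and iM: "integrable M (\<lambda>x. (norm x)\<^sup>2)"
    using M by (auto simp: P2_def)
  obtain q :: "nat \<Rightarrow> 'h \<Rightarrow> real" where q: "\<And>m. continuous_map weak_topology euclideanreal (q m)"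
    "\<And>m. q m \<in> borel_measurable borel"
    "\<And>m x. 0 \<le> q m x" "\<And>m x. q m x \<le> norm x" "\<And>x. (\<lambda>m. q m x) \<longlonglongrightarrow> norm x"
    by (rule weakly_continuous_norm_approx) blast
  note [measurable] = q(2)
  define g where "g m x = min (real m) ((q m x)\<^sup>2)" for m x
  have g: "0 \<le> g m x" "g m x \<le> (norm x)\<^sup>2" "g m x \<le> real m" for m x
    using power_mono[OF q(4) q(3), of m x 2] by (auto simp: g_def)
  have gm [measurable]: "g m \<in> borel_measurable borel" for m unfolding g_def by measurable
  have "(\<lambda>m. \<integral>x. g m x \<partial>M) \<longlonglongrightarrow> (\<integral>x. (norm x)\<^sup>2 \<partial>M)"
  proof (rule integral_dominated_convergence[where w="\<lambda>x. (norm x)\<^sup>2"])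
    have "(\<lambda>m. g m x) \<longlonglongrightarrow> (norm x)\<^sup>2" for x
    proof (rule Lim_transform_eventually)
      show "(\<lambda>m. (q m x)\<^sup>2) \<longlonglongrightarrow> (norm x)\<^sup>2" by (intro tendsto_intros q(5))
      obtain N :: nat where "(norm x)\<^sup>2 \<le> real N" using real_arch_simple by blast
      then have "(q m x)\<^sup>2 = g m x" if "m \<ge> N" for m
        using that power_mono[OF q(4) q(3), of m x 2] unfolding g_def by simp
      then show "\<forall>\<^sub>F m in sequentially. (q m x)\<^sup>2 = g m x" by (auto simp: eventually_sequentially)
    qed
    then show "AE x in M. (\<lambda>m. g m x) \<longlonglongrightarrow> (norm x)\<^sup>2" by simp
  qed (use g iM in auto)
  then have "\<forall>\<^sub>F m in sequentially. c < (\<integral>x. g m x \<partial>M)" using c by (rule order_tendstoD)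
  then obtain m where "c < (\<integral>x. g m x \<partial>M)" by (auto simp: eventually_sequentially)
  moreover have "continuous_map weak_topology euclideanreal (g m)"
    unfolding g_def power2_eq_square
    by (intro continuous_map_real_min continuous_map_real_mult q) auto
  ultimately show ?thesis using that[of "g m" "real m"] g gm by blast
qed

text \<open>If the second moments were unbounded, a lacunary series of truncations of \<open>|x|\<^sup>2\<close> would be an
  admissible test function whose integrals are unbounded.\<close>

lemma P2w_limit_bounded_moments:
  fixes \<sigma> :: "nat \<Rightarrow> 'h::{real_inner,polish_space} measure"
  assumes lim: "limitin P2w_topology \<sigma> l sequentially" and \<sigma>: "\<And>n. \<sigma> n \<in> P2"
  shows "\<exists>C. \<forall>n. (\<integral>x. (norm x)\<^sup>2 \<partial>\<sigma> n) \<le> C"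
proof (rule ccontr)
  assume "\<not> ?thesis"
  then have unb: "\<exists>n. C < (\<integral>x. (norm x)\<^sup>2 \<partial>\<sigma> n)" for C by (auto simp: not_le)
  \<comment> \<open>The factor \<open>2 ^ k\<close> offsets the weight \<open>(1 / 2) ^ k\<close> in
    \<open>\<zeta>\<close>, so that the \<open>k\<close>-th term alone integrates to more than
    \<open>k\<close>.\<close>
  have "\<exists>n (g :: 'h \<Rightarrow> real) T. continuous_map weak_topology euclideanreal g \<and> g \<in> borel_measurable borel \<and>
      (\<forall>x. 0 \<le> g x) \<and> (\<forall>x. g x \<le> (norm x)\<^sup>2) \<and> (\<forall>x. g x \<le> T) \<and> real k * 2 ^ k < (\<integral>x. g x \<partial>\<sigma> n)" for k :: nat
  proof -
    obtain n where "real k * 2 ^ k < (\<integral>x. (norm x)\<^sup>2 \<partial>\<sigma> n)" using unb by blast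
    then show ?thesis by (rule second_moment_weak_lower_bound[OF \<sigma>]) blast
  qed
  then obtain n and g :: "nat \<Rightarrow> 'h \<Rightarrow> real" and T where
    g: "\<And>k. continuous_map weak_topology euclideanreal (g k)" "\<And>k. g k \<in> borel_measurable borel"
      "\<And>k x. 0 \<le> g k x" "\<And>k x. g k x \<le> (norm x)\<^sup>2" "\<And>k x. g k x \<le> T k"
      "\<And>k. real k * 2 ^ k < (\<integral>x. g k x \<partial>\<sigma> (n k))"
    by metis
  note [measurable] = g(2)
  define \<zeta> where "\<zeta> x = (\<Sum>k. (1 / 2) ^ k * g k x)" for x
  have gs: "summable (\<lambda>k. (1 / 2 :: real) ^ k)" by (simp add: summable_geometric)
  have term_le: "(1 / 2) ^ k * g k x \<le> (1 / 2) ^ k * (norm x)\<^sup>2" for k x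
    by (intro mult_left_mono g) auto
  have sm: "summable (\<lambda>k. (1 / 2) ^ k * g k x)" for x
    by (rule summable_comparison_test[OF _ summable_mult2[OF gs, of "(norm x)\<^sup>2"]])
       (use term_le g in auto)
  have \<zeta>0: "0 \<le> \<zeta> x" for x unfolding \<zeta>_def by (rule suminf_nonneg[OF sm]) (simp add: g)
  have \<zeta>_le: "\<zeta> x \<le> 2 * (norm x)\<^sup>2" for x
  proof -
    have "\<zeta> x \<le> (\<Sum>k. (1 / 2) ^ k * (norm x)\<^sup>2)"
      unfolding \<zeta>_def by (rule suminf_le[OF term_le sm summable_mult2[OF gs]])
    also have "\<dots> = 2 * (norm x)\<^sup>2" using suminf_geometric[of "1 / 2 :: real"] by (simp add: suminf_mult2[OF gs, symmetric])
    finally show ?thesis .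
  qed
  \<comment> \<open>Along a weakly convergent sequence the norms are bounded by some
    \<open>B\<close>, so \<open>(1 / 2) ^ k * B\<^sup>2\<close> dominates the series and the limit
    passes termwise.\<close>
  have "seq_weakly_continuous \<zeta>"
    unfolding seq_weakly_continuous_def
  proof (intro allI impI)
    fix x and y :: 'h assume xy: "limitin weak_topology x y sequentially"
    obtain B where B: "\<And>n. norm (x n) \<le> B" using weakly_convergent_bounded[OF xy] by auto
    have "(\<lambda>n. \<Sum>k. (1 / 2) ^ k * g k (x n)) \<longlonglongrightarrow> (\<Sum>k. (1 / 2) ^ k * g k y)"
    proof (rule tannerys_theorem[where M="\<lambda>k. (1 / 2) ^ k * B\<^sup>2", THEN conjunct2, THEN conjunct2])
      show "(\<lambda>n. (1 / 2) ^ k * g k (x n)) \<longlonglongrightarrow> (1 / 2) ^ k * g k y" for k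
        using weakly_continuous_imp_seq[OF g(1)[of k]] xy
        by (intro tendsto_mult_left) (auto simp: seq_weakly_continuous_def)
      have "norm ((1 / 2) ^ k * g k (x n)) \<le> (1 / 2) ^ k * B\<^sup>2" for k n
        using order_trans[OF g(4)[of k "x n"] power_mono[OF B, of n 2]] g(3)[of k "x n"]
        by (simp add: abs_mult mult_left_mono)
      then show "\<forall>\<^sub>F (k, n) in at_top \<times>\<^sub>F sequentially. norm ((1 / 2) ^ k * g k (x n)) \<le> (1 / 2) ^ k * B\<^sup>2"
        by (simp add: case_prod_unfold)
    qed (use summable_mult2[OF gs] in auto)
    then show "(\<lambda>n. \<zeta> (x n)) \<longlonglongrightarrow> \<zeta> y" by (simp add: \<zeta>_def)
  qed
  moreover have "((\<lambda>x. \<zeta> x / (1 + (norm x)\<^sup>2)) \<longlongrightarrow> 0) at_infinity"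
  proof (rule subquadratic_tendsto_0)
    fix \<epsilon> :: real assume \<epsilon>: "\<epsilon> > 0"
    \<comment> \<open>The tail from \<open>K\<close> on is at most \<open>2 * (1 / 2) ^ K\<close>
      times the squared norm, hence within \<open>\<epsilon>\<close> times it; the first
      \<open>K\<close> terms are bounded through the levels \<open>T k\<close>.\<close>
    obtain K where K: "(1 / 2) ^ K < \<epsilon> / 2"
      using real_arch_pow_inv[of "\<epsilon> / 2" "1 / 2"] \<epsilon> by auto
    have "\<bar>\<zeta> x\<bar> \<le> \<epsilon> * (norm x)\<^sup>2 + (\<Sum>k<K. (1 / 2) ^ k * T k)" for x
    proof -
      have "\<zeta> x = (\<Sum>k. (1 / 2) ^ (k + K) * g (k + K) x) + (\<Sum>k<K. (1 / 2) ^ k * g k x)"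
        unfolding \<zeta>_def by (rule suminf_split_initial_segment[OF sm])
      also have "(\<Sum>k. (1 / 2) ^ (k + K) * g (k + K) x) \<le> (\<Sum>k. (1 / 2) ^ k * ((1 / 2) ^ K * (norm x)\<^sup>2))"
        by (rule suminf_le[OF _ summable_ignore_initial_segment[OF sm] summable_mult2[OF gs]])
           (use term_le in \<open>simp add: power_add mult.assoc\<close>)
      also have "\<dots> = 2 * ((1 / 2) ^ K * (norm x)\<^sup>2)"
        using suminf_geometric[of "1 / 2 :: real"] by (simp add: suminf_mult2[OF gs, symmetric])
      also have "\<dots> \<le> \<epsilon> * (norm x)\<^sup>2"
        using mult_right_mono[OF less_imp_le[OF K], of "2 * (norm x)\<^sup>2"] by simp
      also have "(\<Sum>k<K. (1 / 2) ^ k * g k x) \<le> (\<Sum>k<K. (1 / 2) ^ k * T k)"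
        by (intro sum_mono mult_left_mono g) auto
      finally show ?thesis using \<zeta>0[of x] by simp
    qed
    then show "\<exists>B. \<forall>x. \<bar>\<zeta> x\<bar> \<le> \<epsilon> * (norm x)\<^sup>2 + B" by blast
  qed
  ultimately have "\<zeta> \<in> P2w_test_functions" by (simp add: P2w_test_functions_def)
  from P2w_limit_integral[OF lim this] have "Bseq (\<lambda>n. \<integral>x. \<zeta> x \<partial>\<sigma> n)"
    using convergentI convergent_imp_Bseq by blast
  then obtain B where B: "\<And>n. \<bar>\<integral>x. \<zeta> x \<partial>\<sigma> n\<bar> \<le> B" by (auto simp: Bseq_def)
  have \<zeta>m [measurable]: "\<zeta> \<in> borel_measurable borel"
    unfolding \<zeta>_def by measurable
  have big: "real k < (\<integral>x. \<zeta> x \<partial>\<sigma> (n k))" for k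
  proof -
    have [measurable_cong]: "sets (\<sigma> (n k)) = sets borel" and i: "integrable (\<sigma> (n k)) (\<lambda>x. (norm x)\<^sup>2)"
      using \<sigma>[of "n k"] by (auto simp: P2_def)
    have i\<zeta>: "integrable (\<sigma> (n k)) \<zeta>"
      by (rule Bochner_Integration.integrable_bound[OF integrable_mult_right[OF i, of 2]]) (use \<zeta>0 \<zeta>_le in auto)
    have ig: "integrable (\<sigma> (n k)) (g k)"
      by (rule Bochner_Integration.integrable_bound[OF i]) (use g in auto)
    have "(1 / 2) ^ k * g k x \<le> \<zeta> x" for x
      unfolding \<zeta>_def using sum_le_suminf[OF sm, of "{k}" x] g by simp
    then have "(\<integral>x. (1 / 2) ^ k * g k x \<partial>\<sigma> (n k)) \<le> (\<integral>x. \<zeta> x \<partial>\<sigma> (n k))"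
      by (intro integral_mono i\<zeta> integrable_mult_right ig)
    moreover have "real k < (1 / 2) ^ k * (\<integral>x. g k x \<partial>\<sigma> (n k))"
      using g(6)[of k] by (simp add: power_divide field_simps)
    ultimately show ?thesis by simp
  qed
  obtain k :: nat where "B < real k" using reals_Archimedean2 by blast
  then show False using big[of k] B[of "n k"] by linarith
qed

theorem theorem4p2:
  fixes \<phi> :: "'h::{real_inner,polish_space} measure \<Rightarrow> ereal"
  assumes not_minf: "\<And>M. M \<in> P2 \<Longrightarrow> \<phi> M \<noteq> -\<infinity>"
    and proper: "proper_domain \<phi> \<noteq> {}"
    and convex: "geodesically_convex \<phi>"
    and lsc: "W2_lsc \<phi>"
  shows "seq_lsc_in P2w_topology \<phi> \<and>
    (\<forall>(\<mu> :: nat \<Rightarrow> 'h measure) \<mu>\<^sub>0.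
       (\<forall>n. \<mu> n \<in> P2) \<and> \<mu>\<^sub>0 \<in> P2 \<and> narrow_conv_weak \<mu> \<mu>\<^sub>0 \<and>
       bdd_above (range (\<lambda>n. \<integral>x. (norm x)\<^sup>2 \<partial>\<mu> n)) \<longrightarrow>
       liminf (\<lambda>n. \<phi> (\<mu> n)) \<ge> \<phi> \<mu>\<^sub>0)"
proof (intro conjI allI impI)
  show "seq_lsc_in P2w_topology \<phi>"
    unfolding seq_lsc_in_def
  proof (intro allI impI, elim conjE)
    fix \<sigma> and l :: "'h measure"
    assume r: "range \<sigma> \<subseteq> topspace P2w_topology" and lim: "limitin P2w_topology \<sigma> l sequentially"
    have \<sigma>: "\<sigma> n \<in> P2" for n using r by auto
    have l: "l \<in> P2" using lim by (simp add: limitin_def)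
    \<comment> \<open>Convergence in \<open>P2w_topology\<close> supplies both hypotheses of
      \<open>narrow_lsc\<close>: bounded moments here, narrow convergence through
      \<open>P2w_limit_narrow\<close>.\<close>
    obtain C where "\<And>n. (\<integral>x. (norm x)\<^sup>2 \<partial>\<sigma> n) \<le> C"
      using P2w_limit_bounded_moments[OF lim \<sigma>] by blast
    then show "\<phi> l \<le> liminf (\<lambda>n. \<phi> (\<sigma> n))"
      by (rule narrow_lsc[OF convex lsc \<sigma> l P2w_limit_narrow[OF lim]])
  qed
next
  fix \<mu> :: "nat \<Rightarrow> 'h measure" and \<mu>\<^sub>0
  assume a: "(\<forall>n. \<mu> n \<in> P2) \<and> \<mu>\<^sub>0 \<in> P2 \<and> narrow_conv_weak \<mu> \<mu>\<^sub>0 \<and>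
       bdd_above (range (\<lambda>n. \<integral>x. (norm x)\<^sup>2 \<partial>\<mu> n))"
  then obtain C where "\<And>n. (\<integral>x. (norm x)\<^sup>2 \<partial>\<mu> n) \<le> C" by (auto simp: bdd_above_def)
  then show "\<phi> \<mu>\<^sub>0 \<le> liminf (\<lambda>n. \<phi> (\<mu> n))"
    using a by (intro narrow_lsc[OF convex lsc]) auto
qed

end
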